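(* Let $\mathcal{J}=\langle U,f,g\rangle$ be a compact nonexpansive control problem with compact invariant set $Y$. Then its undiscounted value $$\hat V(y_0)=\inf_{\mathbf{u}\in\mathcal{U}}\ \limsup_{t\to\infty}\ \frac1t\int_0^t g\big(\mathbf{y}(s,\mathbf{u},y_0)\big)\,ds,\qquad y_0\in Y,$$ is identical with the general uniform value $V^*$ of $\mathcal{J}$, i.e. $\hat V(y_0)=V^*(y_0)$ for all $y_0\in Y$, where $$V^*(y_0)=\sup_{\theta\in\Delta(\mathbb{R}_+)}\ \inf_{s\in\mathbb{R}_+}\ \inf_{\mathbf{u}\in\mathcal{U}}\int_{0}^{\infty} g\big(\mathbf{y}(t+s,\mathbf{u},y_0)\big)\,d\theta(t).$$
   Context: Setting. $U$ is a compact subset of a separable metric space. A (pure) control is a measurable function $\mathbf{u}:\mathbb{R}_+\to U$; $\mathcal{U}$ is the set of all controls. Consider $\mathbf{y}'(t)=f(\mathbf{y}(t),\mathbf{u}(t))$, $\mathbf{y}(0)=y_0\in\mathbb{R}^d$. Standing assumptions: the running cost $g:\mathbb{R}^d\times U\to\mathbb{R}$ is Borel measurable and bounded; $f:\mathbb{R}^d\times U\to\mathbb{R}^d$ is Borel measurable, there is $L\ge 0$ with $\|f(y,u)-f(\bar y,u)\|\le L\|y-\bar y\|$ for all $y,\bar y\in\mathbb{R}^d$, $u\in U$, and there is $a>0$ with $\|f(y,u)\|\le a(1+\|y\|)$ for all $(y,u)$. Then for every $y_0$ and $\mathbf{u}\in\mathcal{U}$ there is a unique absolutely continuous solution on $\mathbb{R}_+$,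 denoted $t\mapsto\mathbf{y}(t,\mathbf{u},y_0)$. Compact nonexpansive. $\mathcal{J}=\langle U,f,g\rangle$ is compact nonexpansive if: (i) there is a compact set $Y\subseteq\mathbb{R}^d$ that is invariant: $\mathbf{y}(t,\mathbf{u},y_0)\in Y$ for all $t\ge0$, $\mathbf{u}\in\mathcal{U}$, $y_0\in Y$; (ii) $g$ does not depend on $u$ and is continuous in $y\in Y$ (write $g(y)$); (iii) for all $y_1,y_2\in\mathbb{R}^d$, $\sup_{a\in U}\inf_{b\in U}\langle y_1-y_2,f(y_1,a)-f(y_2,b)\rangle\le 0$. Evaluations. $\Delta(\mathbb{R}_+)$ is the set of (Borel) probability measures on $\mathbb{R}_+=[0,+\infty)$. For $\theta\in\Delta(\mathbb{R}_+)$, $\gamma_\theta(y_0,\mathbf{u})=\int_{[0,+\infty)} g(\mathbf{y}(t,\mathbf{u},y_0))\,d\theta(t)$ and $V_\theta(y_0)=\inf_{\mathbf{u}\in\mathcal{U}}\gamma_\theta(y_0,\mathbf{u})$. For $s\ge 0$, $TV_s(\theta)=\max_{Q\in\mathcal{B}(\mathbb{R}_+)}|\theta(Q)-\theta(Q+s)|$, with $\mathcal{B}(\mathbb{R}_+)$ the Borel subsets of $\mathbb{R}_+$. Random controls. A random control is a pair $((\Omega,\mathcal{B}(\Omega),\lambda),\mathbf{u})$ with $(\Omega,\mathcal{B}(\Omega),\lambda)$ a standard Borel probability space and $\mathbf{u}:Y\times\Omega\times[0,+\infty)\to U$ Borel measurable; $\mathbf{u}_\omega(y_0)=\mathbf{u}(y_0,\omega,\cdot)\in\mathcal{U}$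 and $\gamma_\theta(y_0,\mathbf{u})=\int_\Omega\gamma_\theta(y_0,\mathbf{u}_\omega(y_0))\,d\lambda(\omega)$. General uniform value. A function $V:Y\to\mathbb{R}$ is the general uniform value of $\mathcal{J}$ if (1) for each $\varepsilon>0$ there are $\eta>0,S>0$ such that every $\theta\in\Delta(\mathbb{R}_+)$ with $\sup_{0\le s\le S}TV_s(\theta)\le\eta$ satisfies $|V_\theta(y_0)-V(y_0)|\le\varepsilon$ for all $y_0\in Y$; and (2) for each $\varepsilon>0$ there are $\eta>0$, $S>0$ and a random control $\mathbf{u}$ such that every $\theta\in\Delta(\mathbb{R}_+)$ with $\sup_{0\le s\le S}TV_s(\theta)\le\eta$ satisfies $\gamma_\theta(y_0,\mathbf{u})\le V(y_0)+\varepsilon$ for all $y_0\in Y$. In the paper, the general uniform value of a compact nonexpansive problem is the function $V^*$ displayed in the claim. *)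

theory Defs
  imports "HOL-Probability.Probability"
begin

text \<open>
  A control problem consists of a control set \<open>U\<close>, dynamics \<open>f\<close> and a running cost \<open>g\<close>.
  Only problems whose running cost does not depend on the control are considered, so \<open>g\<close> is
  a function of the state alone. The state space is an arbitrary Euclidean space, and the
  ambient space of \<open>U\<close> is a separable (equivalently, second countable) metric space.

  Functions on the half-line are total functions on \<open>real\<close>; their values at negative
  arguments are irrelevant. Values, suprema, infima and upper limits are taken in \<open>ereal\<close>.
\<close>

definition controls :: "'u::topological_space set \<Rightarrow> (real \<Rightarrow> 'u) set" where
  "controls U = restrict_space borel {0..} \<rightarrow>\<^sub>M restrict_space borel U"

definition control_problem ::
  "'u::{metric_space, second_countable_topology} set \<Rightarrow>
   ('a::euclidean_space \<Rightarrow> 'u \<Rightarrow> 'a) \<Rightarrow> ('a \<Rightarrow> real) \<Rightarrow> bool" where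
  "control_problem U f g \<longleftrightarrow>
     compact U \<and>
     g \<in> borel_measurable borel \<and> bounded (range g) \<and>
     (\<lambda>(y, u). f y u) \<in> borel_measurable (restrict_space borel (UNIV \<times> U)) \<and>
     (\<exists>L\<ge>0. \<forall>y y'. \<forall>u\<in>U. norm (f y u - f y' u) \<le> L * norm (y - y')) \<and>
     (\<exists>a>0. \<forall>y. \<forall>u\<in>U. norm (f y u) \<le> a * (1 + norm y))"

definition absolutely_continuous_on_interval ::
  "real \<Rightarrow> real \<Rightarrow> (real \<Rightarrow> 'a::real_normed_vector) \<Rightarrow> bool" where
  "absolutely_continuous_on_interval a b y \<longleftrightarrow>
     (\<forall>e>0. \<exists>d>0. \<forall>D. finite D \<longrightarrow>
        (\<forall>(s, t)\<in>D. a \<le> s \<and> s \<le> t \<and> t \<le> b) \<longrightarrow>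
        disjoint_family_on (\<lambda>(s, t). {s<..<t}) D \<longrightarrow>
        (\<Sum>(s, t)\<in>D. t - s) < d \<longrightarrow>
        (\<Sum>(s, t)\<in>D. norm (y t - y s)) < e)"

text \<open>Absolute continuity on the half-line means absolute continuity on every \<open>{0..T}\<close>.\<close>

definition is_trajectory ::
  "('a::euclidean_space \<Rightarrow> 'u \<Rightarrow> 'a) \<Rightarrow> (real \<Rightarrow> 'u) \<Rightarrow> 'a \<Rightarrow> (real \<Rightarrow> 'a) \<Rightarrow> bool" where
  "is_trajectory f u y0 y \<longleftrightarrow>
     y 0 = y0 \<and>
     (\<forall>T\<ge>0. absolutely_continuous_on_interval 0 T y) \<and>
     (AE t in lborel. 0 < t \<longrightarrow> (y has_vector_derivative f (y t) (u t)) (at t))"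

text \<open>
  Under \<open>control_problem\<close>, and for \<open>u \<in> controls U\<close>, a trajectory exists and any two
  agree on \<open>{0..}\<close>; the choice below therefore only concerns negative times.
\<close>

definition trajectory ::
  "('a::euclidean_space \<Rightarrow> 'u \<Rightarrow> 'a) \<Rightarrow> (real \<Rightarrow> 'u) \<Rightarrow> 'a \<Rightarrow> real \<Rightarrow> 'a" where
  "trajectory f u y0 = (SOME y. is_trajectory f u y0 y)"

definition compact_nonexpansive ::
  "'u::{metric_space, second_countable_topology} set \<Rightarrow>
   ('a::euclidean_space \<Rightarrow> 'u \<Rightarrow> 'a) \<Rightarrow> ('a \<Rightarrow> real) \<Rightarrow> 'a set \<Rightarrow> bool" where
  "compact_nonexpansive U f g Y \<longleftrightarrow>
     control_problem U f g \<and>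
     compact Y \<and>
     (\<forall>y0\<in>Y. \<forall>u\<in>controls U. \<forall>t\<ge>0. trajectory f u y0 t \<in> Y) \<and>
     continuous_on Y g \<and>
     (\<forall>y1 y2. (SUP a\<in>U. INF b\<in>U. ereal ((y1 - y2) \<bullet> (f y1 a - f y2 b))) \<le> 0)"

definition evaluations :: "real measure set" where
  "evaluations = {\<theta>. prob_space \<theta> \<and> sets \<theta> = sets (restrict_space borel {0..})}"

definition payoff ::
  "('a::euclidean_space \<Rightarrow> 'u \<Rightarrow> 'a) \<Rightarrow> ('a \<Rightarrow> real) \<Rightarrow> real measure \<Rightarrow> 'a \<Rightarrow> (real \<Rightarrow> 'u) \<Rightarrow> real"
where
  "payoff f g \<theta> y0 u = (LINT t|\<theta>. g (trajectory f u y0 t))"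

definition value_at ::
  "'u::topological_space set \<Rightarrow> ('a::euclidean_space \<Rightarrow> 'u \<Rightarrow> 'a) \<Rightarrow> ('a \<Rightarrow> real) \<Rightarrow>
   real measure \<Rightarrow> 'a \<Rightarrow> ereal" where
  "value_at U f g \<theta> y0 = (INF u\<in>controls U. ereal (payoff f g \<theta> y0 u))"

definition TV :: "real \<Rightarrow> real measure \<Rightarrow> real" where
  "TV s \<theta> = (SUP Q\<in>sets (restrict_space borel {0..}).
      \<bar>measure \<theta> Q - measure \<theta> ((\<lambda>t. t + s) ` Q)\<bar>)"

text \<open>
  Every standard Borel space is Borel isomorphic to a Borel subset of the real line, so the
  probability spaces of random controls are taken to be of this form.
\<close>

definition random_control ::
  "'u::topological_space set \<Rightarrow> 'a::euclidean_space set \<Rightarrow> real measure \<Rightarrow>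
   ('a \<Rightarrow> real \<Rightarrow> real \<Rightarrow> 'u) \<Rightarrow> bool" where
  "random_control U Y \<Lambda> u \<longleftrightarrow>
     prob_space \<Lambda> \<and> space \<Lambda> \<in> sets borel \<and>
     sets \<Lambda> = sets (restrict_space borel (space \<Lambda>)) \<and>
     (\<lambda>(y, \<omega>, t). u y \<omega> t) \<in>
       restrict_space borel (Y \<times> space \<Lambda> \<times> {0..}) \<rightarrow>\<^sub>M restrict_space borel U"

definition random_payoff ::
  "('a::euclidean_space \<Rightarrow> 'u \<Rightarrow> 'a) \<Rightarrow> ('a \<Rightarrow> real) \<Rightarrow> real measure \<Rightarrow> 'a \<Rightarrow>
   real measure \<Rightarrow> ('a \<Rightarrow> real \<Rightarrow> real \<Rightarrow> 'u) \<Rightarrow> real" where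
  "random_payoff f g \<theta> y0 \<Lambda> u = (LINT \<omega>|\<Lambda>. payoff f g \<theta> y0 (u y0 \<omega>))"

definition general_uniform_value ::
  "'u::topological_space set \<Rightarrow> ('a::euclidean_space \<Rightarrow> 'u \<Rightarrow> 'a) \<Rightarrow> ('a \<Rightarrow> real) \<Rightarrow>
   'a set \<Rightarrow> ('a \<Rightarrow> real) \<Rightarrow> bool" where
  "general_uniform_value U f g Y V \<longleftrightarrow>
     (\<forall>\<epsilon>>0. \<exists>\<eta>>0. \<exists>S>0. \<forall>\<theta>\<in>evaluations. (SUP s\<in>{0..S}. TV s \<theta>) \<le> \<eta> \<longrightarrow>
        (\<forall>y0\<in>Y. \<bar>value_at U f g \<theta> y0 - ereal (V y0)\<bar> \<le> ereal \<epsilon>)) \<and>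
     (\<forall>\<epsilon>>0. \<exists>\<eta>>0. \<exists>S>0. \<exists>\<Lambda> u. random_control U Y \<Lambda> u \<and>
        (\<forall>\<theta>\<in>evaluations. (SUP s\<in>{0..S}. TV s \<theta>) \<le> \<eta> \<longrightarrow>
           (\<forall>y0\<in>Y. random_payoff f g \<theta> y0 \<Lambda> u \<le> V y0 + \<epsilon>)))"

definition undiscounted_value ::
  "'u::topological_space set \<Rightarrow> ('a::euclidean_space \<Rightarrow> 'u \<Rightarrow> 'a) \<Rightarrow> ('a \<Rightarrow> real) \<Rightarrow>
   'a \<Rightarrow> ereal" where
  "undiscounted_value U f g y0 =
     (INF u\<in>controls U.
        Limsup at_top (\<lambda>t::real. ereal (1 / t * (LINT s:{0..t}|lborel. g (trajectory f u y0 s)))))"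

definition Vstar ::
  "'u::topological_space set \<Rightarrow> ('a::euclidean_space \<Rightarrow> 'u \<Rightarrow> 'a) \<Rightarrow> ('a \<Rightarrow> real) \<Rightarrow>
   'a \<Rightarrow> ereal" where
  "Vstar U f g y0 =
     (SUP \<theta>\<in>evaluations. INF s\<in>{0..}. INF u\<in>controls U.
        ereal (LINT t|\<theta>. g (trajectory f u y0 (t + s))))"

end

theory Submission
  imports Defs
begin

text \<open>Write \<open>W\<close> for the value \<open>Vstar U f g y0\<close>.

\<^emph>\<open>No control has a long-run average below \<open>W\<close>.\<close> Let \<open>\<theta>\<close> be an evaluation that guarantees more than
\<open>c\<close> after every delay \<open>s\<close>. Averaging the guarantee over \<open>s \<in> [0, T]\<close> and exchanging the two integrals
turns it into a bound on the \<open>\<theta>\<close>-mean of the averages of the running cost over \<open>[t, t + T]\<close>. Such an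
average differs from the one over \<open>[0, T]\<close> by at most \<open>2 M t / T\<close>, which vanishes as \<open>T\<close> grows. Thus
all averages over \<open>[0, T]\<close> are at least \<open>c\<close> for large \<open>T\<close>, uniformly in the control
(\<open>below_Vstar_imp_below_averages\<close>).

\<^emph>\<open>Some control has upper long-run average at most \<open>W + \<epsilon>\<close>.\<close> Testing \<open>W\<close> with the uniform evaluations
on \<open>[0, N]\<close> shows that for each \<open>N\<close> a state can be reached from which \<open>N\<close> time units can be spent at
average cost about \<open>W\<close> or less. The difficulty is to glue such pieces into one control, because the pieces
for different \<open>N\<close> start at different states, which may become unreachable from one another. Two facts
make it possible.

\<^item> Nonexpansiveness: if \<open>b\<close> nearly maximises \<open>\<langle>y - z, f z b\<rangle>\<close>, then the condition on the
  Hamiltonians says that \<open>b\<close> answers every control used at \<open>y\<close>. Hence a trajectory starting at \<open>z\<close>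
  can follow one starting at \<open>y\<close> without increasing the distance, using a control that is constant
  on short intervals and depends only on the two sampled states (\<open>unit_time_response\<close>). Sampled at
  integer times, the problem becomes a dynamic program on a compact space in which every finite play
  can be imitated from nearby states.

\<^item> Compactness: in such a dynamic program the approximate goal of any transit is reached within a
  time that depends only on the precision (\<open>bounded_transit\<close>), and the end states of arbitrarily long
  good pieces cluster, so that one of them is itself the start of arbitrarily long good pieces
  (\<open>good_block_reachable\<close>).

Hence one alternates transits of bounded length \<open>l k\<close> with blocks whose partial averages all stay
below \<open>W + \<epsilon>\<close>, the precision improving geometrically with the stage \<open>k\<close>. Each block is chosen so long
that what it saves pays for the next transit, whose length bound is known in advance
(\<open>good_infinite_play\<close>).

A general uniform value is, by definition, the limit of the values for uniform evaluations on
\<open>[0, T]\<close>, since these have total variation at most \<open>s / T\<close> under a shift by \<open>s\<close>. The two halves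
above enclose this limit between \<open>Vstar\<close> and the undiscounted value.

Trajectories are handled through the equivalent integral equation. The equivalence rests on the
fundamental theorem of calculus for absolutely continuous functions and on Lebesgue's differentiation
theorem; global existence comes from Banach's fixed point theorem in an exponentially weighted norm.\<close>

section \<open>Absolutely continuous functions and indefinite integrals\<close>

text \<open>The gauge integral gives a direct proof. Tags outside the null set \<open>N\<close> are treated as for a
differentiable function. Tags in \<open>N\<close> are forced by the gauge into an open set of small measure, where
absolute continuity makes the total increment of \<open>y\<close> small.\<close>

lemma absolutely_continuous_has_integral:
  fixes y :: "real \<Rightarrow> 'a::banach"
  assumes "a \<le> b" and ac: "absolutely_continuous_on_interval a b y"
    and N: "negligible N"
    and der: "\<And>x. x \<in> {a..b} - N \<Longrightarrow> (y has_vector_derivative h x) (at x within {a..b})"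
  shows "(h has_integral (y b - y a)) {a..b}"
proof -
  \<comment> \<open>the same integral as for \<open>h\<close>, but tags in \<open>N\<close> contribute nothing to the Riemann sum\<close>
  define h0 where "h0 x = (if x \<in> N then 0 else h x)" for x
  have "(h0 has_integral (y b - y a)) (cbox a b)"
    unfolding has_integral
  proof safe
    fix e :: real assume "e > 0"
    define e1 where "e1 = e / (2 * (b - a + 1))"
    have e1: "e1 > 0" "e1 * (b - a) < e / 2"
      using \<open>e > 0\<close> \<open>a \<le> b\<close> by (auto simp: e1_def field_simps)
    obtain \<delta> where "\<delta> > 0" and \<delta>': "\<forall>D. finite D \<longrightarrow>
        (\<forall>(s, t)\<in>D. a \<le> s \<and> s \<le> t \<and> t \<le> b) \<longrightarrow>
        disjoint_family_on (\<lambda>(s, t). {s<..<t}) D \<longrightarrow>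
        (\<Sum>(s, t)\<in>D. t - s) < \<delta> \<longrightarrow> (\<Sum>(s, t)\<in>D. norm (y t - y s)) < e / 2"
      using ac[unfolded absolutely_continuous_on_interval_def, rule_format, of "e / 2"] \<open>e > 0\<close> by auto
    have \<delta>: "(\<Sum>(s, t)\<in>D. norm (y t - y s)) < e / 2"
      if "finite D" "\<forall>(s, t)\<in>D. a \<le> s \<and> s \<le> t \<and> t \<le> b"
        "disjoint_family_on (\<lambda>(s, t). {s<..<t}) D" "(\<Sum>(s, t)\<in>D. t - s) < \<delta>" for D
      using \<delta>' that by blast
    obtain G where G: "open G" "N \<subseteq> G" "G \<in> lmeasurable" "measure lebesgue G < \<delta>"
    proof -
      obtain T where T: "open T" "N \<subseteq> T" "T - N \<in> lmeasurable" "emeasure lebesgue (T - N) < ennreal \<delta>"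
        using sets_lebesgue_outer_open[of N \<delta>] N \<open>\<delta> > 0\<close> negligible_imp_sets by metis
      have "T \<in> lmeasurable" "measure lebesgue T < \<delta>"
      proof -
        have "T = (T - N) \<union> N" using T(2) by auto
        moreover have "measure lebesgue ((T - N) \<union> N) \<le> measure lebesgue (T - N) + measure lebesgue N"
          using T(3) N by (intro measure_Un_le) (auto simp: negligible_imp_sets)
        moreover have "measure lebesgue N = 0" using N by (simp add: negligible_imp_measure0)
        moreover have "measure lebesgue (T - N) < \<delta>"
          using T(4) \<open>\<delta> > 0\<close> unfolding emeasure_eq_measure2[OF T(3)] by (simp add: ennreal_less_iff)
        ultimately show "measure lebesgue T < \<delta>" by simp
        have "N \<in> lmeasurable" using N negligible_iff_measure by blast
        then show "T \<in> lmeasurable"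
          using T(3) \<open>T = (T - N) \<union> N\<close> by (metis fmeasurable.Un)
      qed
      then show ?thesis using that T by blast
    qed
    have "\<forall>x. \<exists>d>0. x \<in> {a..b} - N \<longrightarrow>
         (\<forall>z\<in>{a..b}. norm (z-x) < d \<longrightarrow> norm (y z - y x - (z-x) *\<^sub>R h x) \<le> e1 * norm (z-x))"
      using der[unfolded has_vector_derivative_def has_derivative_within_alt] e1(1)
      by (meson zero_less_one)
    then obtain d where d: "\<And>x. 0 < d x"
        "\<And>x z. \<lbrakk>x \<in> {a..b} - N; z \<in> {a..b}; norm (z-x) < d x\<rbrakk>
           \<Longrightarrow> norm (y z - y x - (z-x) *\<^sub>R h x) \<le> e1 * norm (z-x)"
      by metis
    define \<gamma> where "\<gamma> x = (if x \<in> N then G else ball x (d x))" for x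
    have "gauge \<gamma>" using G d(1) by (auto simp: gauge_def \<gamma>_def)
    have close: "norm ((\<Sum>(x, K)\<in>p. measure lborel K *\<^sub>R h0 x) - (y b - y a)) < e"
      if ptag: "p tagged_division_of cbox a b" and fine: "\<gamma> fine p" for p
    proof -
      have fin: "finite p" using ptag by blast
      have K: "\<exists>u v. K = {u..v} \<and> u \<le> x \<and> x \<le> v \<and> a \<le> u \<and> v \<le> b" if "(x, K) \<in> p" for x K
      proof -
        have "x \<in> K" "K \<subseteq> cbox a b" "\<exists>u v. K = cbox u v"
          using tagged_division_ofD[OF ptag] that by auto
        then show ?thesis by force
      qed
      have fineD: "K \<subseteq> \<gamma> x" if "(x, K) \<in> p" for x K using fine that by (auto simp: fine_def)
      have y_eq: "y b - y a = (\<Sum>(x,K)\<in>p. y (Sup K) - y (Inf K))"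
        and ba: "b - a = (\<Sum>(x,K)\<in>p. Sup K - Inf K)"
        using additive_tagged_division_1[where f= y] additive_tagged_division_1[where f= "\<lambda>x. x"]
          \<open>a \<le> b\<close> ptag by auto
      define R where "R = (\<lambda>(x,K). measure lborel K *\<^sub>R h0 x - (y (Sup K) - y (Inf K)))"
      define pN where "pN = {(x,K)\<in>p. x \<in> N}"
      have pN: "finite pN" "pN \<subseteq> p"
        using finite_subset[OF _ fin, of pN] by (auto simp: pN_def)
      have good: "norm (\<Sum>q\<in>p - pN. R q) \<le> e1 * (b - a)"
      proof -
        have "norm (\<Sum>q\<in>p - pN. R q) \<le> (\<Sum>q\<in>p - pN. e1 * (case q of (x, K) \<Rightarrow> Sup K - Inf K))"
        proof (rule sum_norm_le)
          fix q assume "q \<in> p - pN"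
          then obtain x K where q: "q = (x, K)" "(x, K) \<in> p" "x \<notin> N" by (auto simp: pN_def)
          obtain u v where uv: "K = {u..v}" "u \<le> x" "x \<le> v" "a \<le> u" "v \<le> b" using K[OF q(2)] by blast
          have ball: "K \<subseteq> ball x (d x)" using fineD[OF q(2)] q(3) by (simp add: \<gamma>_def)
          have "u \<in> K" "v \<in> K" using uv by auto
          have "norm ((v - u) *\<^sub>R h x - (y v - y u)) = norm (y u - y x - (u - x) *\<^sub>R h x - (y v - y x - (v - x) *\<^sub>R h x))"
            by (auto simp: algebra_simps)
          also have "\<dots> \<le> norm (y u - y x - (u - x) *\<^sub>R h x) + norm (y v - y x - (v - x) *\<^sub>R h x)"
            by (rule norm_triangle_ineq4)
          also have "\<dots> \<le> e1 * norm (u - x) + e1 * norm (v - x)"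
          proof (intro add_mono d(2))
            show "norm (u - x) < d x" "norm (v - x) < d x"
              using subsetD[OF ball \<open>u \<in> K\<close>] subsetD[OF ball \<open>v \<in> K\<close>] by (simp_all add: dist_norm norm_minus_commute)
          qed (use uv q(3) in auto)
          also have "\<dots> = e1 * (v - u)" using uv by (simp add: algebra_simps)
          finally show "norm (R q) \<le> e1 * (case q of (x, K) \<Rightarrow> Sup K - Inf K)"
            using uv q by (simp add: R_def h0_def)
        qed
        also have "\<dots> \<le> (\<Sum>q\<in>p. e1 * (case q of (x, K) \<Rightarrow> Sup K - Inf K))"
          using fin K e1 by (intro sum_mono2) (auto dest!: K)
        also have "\<dots> = e1 * (b - a)" by (simp add: ba sum_distrib_left)
        finally show ?thesis .
      qed
      have bad: "norm (\<Sum>q\<in>pN. R q) < e / 2"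
      proof -
        \<comment> \<open>absolute continuity speaks of pairs of end points, a tagged division of pairs of a tag and an interval\<close>
        define E where "E = (\<lambda>(x::real,K::real set). (Inf K, Sup K))"
        have E: "E (x, K) = (u, v)" if "K = {u..v}" "u \<le> v" for x K u v using that by (simp add: E_def)
        have disj: "interior K \<inter> interior K' = {}"
          if "(x,K) \<in> p" "(x',K') \<in> p" "(x,K) \<noteq> (x',K')" for x K x' K'
          using tagged_division_ofD(5)[OF ptag that(1,2,3)] .
        have disj': "{u<..<v} \<inter> {u'<..<v'} = {}"
          if "(x,{u..v}) \<in> p" "(x',{u'..v'}) \<in> p" "(x,{u..v}) \<noteq> (x',{u'..v'})" for x u v x' u' v'
          using disj[OF that] by (simp add: interior_atLeastAtMost_real)
        have inj: "inj_on E pN"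
        proof (rule inj_onI)
          fix q q' assume *: "q \<in> pN" "q' \<in> pN" "E q = E q'"
          obtain x u v where q: "q = (x, {u..v})" "u \<le> x" "x \<le> v" "(x, {u..v}) \<in> p"
            using *(1) K by (cases q) (force simp: pN_def)
          obtain x' u' v' where q': "q' = (x', {u'..v'})" "u' \<le> x'" "x' \<le> v'" "(x', {u'..v'}) \<in> p"
            using *(2) K by (cases q') (force simp: pN_def)
          have "u = u'" "v = v'" using * q q' by (auto simp: E_def)
          show "q = q'"
          proof (rule ccontr)
            assume "q \<noteq> q'"
            then have "{u<..<v} \<inter> {u<..<v} = {}" using disj'[OF q(4) q'(4)] q q' \<open>u = u'\<close> \<open>v = v'\<close> by auto
            then have "u = v" using q by auto
            then show False using \<open>q \<noteq> q'\<close> q q' \<open>u = u'\<close> \<open>v = v'\<close> by auto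
          qed
        qed
        have "norm (\<Sum>q\<in>pN. R q) \<le> (\<Sum>q\<in>pN. case E q of (s, t) \<Rightarrow> norm (y t - y s))"
          by (rule sum_norm_le) (auto simp: R_def E_def pN_def h0_def norm_minus_commute)
        also have "\<dots> = (\<Sum>(s, t)\<in>E ` pN. norm (y t - y s))"
          by (simp add: sum.reindex[OF inj] o_def)
        also have "\<dots> < e / 2"
        proof (rule \<delta>)
          show "finite (E ` pN)" using pN by simp
          show "\<forall>(s, t)\<in>E ` pN. a \<le> s \<and> s \<le> t \<and> t \<le> b"
            using K by (auto simp: pN_def E_def dest!: K)
          show dis: "disjoint_family_on (\<lambda>(s, t). {s<..<t}) (E ` pN)"
          unfolding disjoint_family_on_def
          proof (intro ballI impI)
            fix z z' assume z: "z \<in> E ` pN" "z' \<in> E ` pN" "z \<noteq> z'"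
            obtain x K s t where z1: "z = (s, t)" "(x, K) \<in> pN" "(s, t) = E (x, K)" using z(1) by (cases z) auto
            obtain x' K' s' t' where z2: "z' = (s', t')" "(x', K') \<in> pN" "(s', t') = E (x', K')" using z(2) by (cases z') auto
            have *: "(x, K) \<in> pN" "(x', K') \<in> pN" "(s, t) = E (x, K)" "(s', t') = E (x', K')"
              "s = s' \<longrightarrow> t \<noteq> t'" using z z1 z2 by auto
            obtain u v where q: "K = {u..v}" "u \<le> x" "x \<le> v" using * K[of x K] by (auto simp: pN_def)
            obtain u' v' where q': "K' = {u'..v'}" "u' \<le> x'" "x' \<le> v'" using * K[of x' K'] by (auto simp: pN_def)
            have "s = u" "t = v" "s' = u'" "t' = v'" using * q q' by (auto simp: E_def)
            then show "(case z of (s, t) \<Rightarrow> {s<..<t}) \<inter> (case z' of (s, t) \<Rightarrow> {s<..<t}) = {}"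
              using disj'[of x u v x' u' v'] * q q' z1 z2 by (auto simp: pN_def)
          qed
          have sub: "{s<..<t} \<subseteq> G" "s \<le> t" if st: "(s, t) \<in> E ` pN" for s t
          proof -
            obtain x K where q: "(x, K) \<in> pN" "(s, t) = E (x, K)" using st by auto
            obtain u v where K': "K = {u..v}" "u \<le> x" "x \<le> v" using K[of x K] q by (auto simp: pN_def)
            have "K \<subseteq> G" using fineD[of x K] q by (auto simp: \<gamma>_def pN_def)
            then show "{s<..<t} \<subseteq> G" "s \<le> t" using q K' by (auto simp: E_def subset_iff)
          qed
          have finIoo: "emeasure lborel {l<..<u} \<noteq> \<infinity>" for l u :: real
            by (cases "l \<le> u") auto
          have "(\<Sum>(s, t)\<in>E ` pN. t - s) = (\<Sum>z\<in>E ` pN. measure lebesgue (case z of (s,t) \<Rightarrow> {s<..<t}))"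
            using sub(2) by (intro sum.cong) auto
          also have "\<dots> = measure lebesgue (\<Union>z\<in>E ` pN. case z of (s,t) \<Rightarrow> {s<..<t})"
            using pN dis by (intro measure_finite_Union[symmetric]) (auto split: prod.splits simp: finIoo[unfolded infinity_ennreal_def])
          also have "\<dots> \<le> measure lebesgue G"
          proof (rule measure_mono_fmeasurable)
            show "(\<Union>z\<in>E ` pN. case z of (s,t) \<Rightarrow> {s<..<t}) \<subseteq> G"
              using sub(1) by (intro UN_least) (simp add: split_beta)
            show "(\<Union>z\<in>E ` pN. case z of (s,t) \<Rightarrow> {s<..<t}) \<in> sets lebesgue"
              using pN by (intro sets.finite_UN) (auto simp: split_beta)
          qed (use G in auto)
          finally show "(\<Sum>(s, t)\<in>E ` pN. t - s) < \<delta>" using G by simp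
        qed
        finally show ?thesis .
      qed
      have "(\<Sum>(x, K)\<in>p. measure lborel K *\<^sub>R h0 x) - (y b - y a) = (\<Sum>q\<in>p. R q)"
        unfolding y_eq R_def by (simp add: sum_subtractf split_def)
      also have "\<dots> = (\<Sum>q\<in>p - pN. R q) + (\<Sum>q\<in>pN. R q)"
        by (rule sum.subset_diff[OF pN(2) fin])
      finally show ?thesis
        using norm_triangle_ineq[of "\<Sum>q\<in>p - pN. R q" "\<Sum>q\<in>pN. R q"] good bad e1(2) by simp
    qed
    show "\<exists>\<gamma>. gauge \<gamma> \<and> (\<forall>\<D>. \<D> tagged_division_of cbox a b \<and> \<gamma> fine \<D> \<longrightarrow>
        norm ((\<Sum>(x, K)\<in>\<D>. measure lborel K *\<^sub>R h0 x) - (y b - y a)) < e)"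
      using \<open>gauge \<gamma>\<close> close by (intro exI[of _ \<gamma>] conjI allI impI) simp_all
  qed
  then show ?thesis
    using has_integral_spike[OF N, of "{a..b}" h h0] by (simp add: h0_def)
qed

text \<open>The differentiation theorem for cubes with lower corner \<open>x\<close>, in dimension one and with the division by
\<open>h\<close> cleared.\<close>

lemma AE_indefinite_integral_right:
  fixes f :: "real \<Rightarrow> 'a::euclidean_space"
  assumes int: "\<And>a b. f integrable_on {a..b}"
  obtains N where "negligible N"
    "\<And>x e. x \<notin> N \<Longrightarrow> 0 < e \<Longrightarrow> \<exists>d>0. \<forall>h. 0 < h \<and> h < d \<longrightarrow>
       norm (integral {x..x + h} f - h *\<^sub>R f x) \<le> e * h"
proof -
  obtain N where N: "negligible N"
    "\<And>x e. x \<notin> N \<Longrightarrow> 0 < e \<Longrightarrow> \<exists>d>0. \<forall>h. 0 < h \<and> h < d \<longrightarrow>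
      norm (integral (cbox x (x + h *\<^sub>R One)) f /\<^sub>R h ^ DIM(real) - f x) < e"
  proof -
    have *: "f integrable_on cbox a b" for a b using int[of a b] by simp
    show thesis
      by (rule integrable_ccontinuous_explicit[OF *]) (rule that; assumption)
  qed
  show ?thesis
  proof (rule that[OF N(1)])
    fix x e :: real assume "x \<notin> N" "0 < e"
    then have "\<exists>d>0. \<forall>h. 0 < h \<and> h < d \<longrightarrow>
      norm (integral (cbox x (x + h *\<^sub>R One)) f /\<^sub>R h ^ DIM(real) - f x) < e"
      by (rule N(2))
    then obtain d where "d > 0" and d: "\<forall>h. 0 < h \<and> h < d \<longrightarrow>
      norm (integral (cbox x (x + h *\<^sub>R One)) f /\<^sub>R h ^ DIM(real) - f x) < e"
      by (elim exE conjE) (rule that; assumption)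
    have "norm (integral {x..x + h} f - h *\<^sub>R f x) \<le> e * h" if "0 < h" "h < d" for h
    proof -
      define X where "X = integral {x..x+h} f /\<^sub>R h - f x"
      have "norm X < e" using d[rule_format, of h] that by (simp add: X_def)
      moreover have "integral {x..x + h} f - h *\<^sub>R f x = h *\<^sub>R X"
        using that by (simp add: X_def scaleR_diff_right)
      ultimately show ?thesis using that by (simp add: mult.commute[of h])
    qed
    then show "\<exists>d>0. \<forall>h. 0 < h \<and> h < d \<longrightarrow> norm (integral {x..x + h} f - h *\<^sub>R f x) \<le> e * h"
      using \<open>d > 0\<close> by (intro exI[of _ d] conjI allI impI) simp_all
  qed
qed

text \<open>Lebesgue's theorem for the right derivative of \<open>f\<close> at \<open>t\<close>, combined with the same statement for the
reflected function at \<open>- t\<close>, which controls the left derivative.\<close>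

lemma AE_indefinite_integral_has_vector_derivative:
  fixes f y :: "real \<Rightarrow> 'a::euclidean_space"
  assumes int: "\<And>a b. f integrable_on {a..b}"
    and y: "\<And>s t. 0 \<le> s \<Longrightarrow> s \<le> t \<Longrightarrow> y t - y s = integral {s..t} f"
  shows "AE t in lborel. 0 < t \<longrightarrow> (y has_vector_derivative f t) (at t)"
proof -
  obtain N1 where N1: "negligible N1"
    "\<And>x e. x \<notin> N1 \<Longrightarrow> 0 < e \<Longrightarrow> \<exists>d>0. \<forall>h. 0 < h \<and> h < d \<longrightarrow>
       norm (integral {x..x + h} f - h *\<^sub>R f x) \<le> e * h"
    using AE_indefinite_integral_right[OF int] by metis
  have int': "(\<lambda>x. f (- x)) integrable_on {a..b}" for a b
    using int[of "-b" "-a"] Henstock_Kurzweil_Integration.integrable_reflect_real[of f "- a" "- b"] by simp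
  obtain N2 where N2: "negligible N2"
    "\<And>x e. x \<notin> N2 \<Longrightarrow> 0 < e \<Longrightarrow> \<exists>d>0. \<forall>h. 0 < h \<and> h < d \<longrightarrow>
       norm (integral {x..x + h} (\<lambda>x. f (- x)) - h *\<^sub>R f (- x)) \<le> e * h"
    using AE_indefinite_integral_right[OF int'] by metis
  define N where "N = N1 \<union> uminus ` N2"
  have "negligible (uminus ` N2)"
    using N2(1) by (intro negligible_differentiable_image_negligible) (auto simp: differentiable_on_def)
  then have neg: "negligible N" using N1(1) by (simp add: N_def)
  have der: "(y has_vector_derivative f t) (at t)" if "t \<notin> N" "0 < t" for t
    unfolding has_vector_derivative_def has_derivative_at_alt
  proof (intro conjI allI impI)
    show "bounded_linear (\<lambda>x. x *\<^sub>R f t)" by (rule bounded_linear_scaleR_left)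
    fix e :: real assume "e > 0"
    have "t \<notin> N1" "- t \<notin> N2" using that by (force simp: N_def)+
    obtain d1 where d1: "d1 > 0" "\<And>h. 0 < h \<Longrightarrow> h < d1 \<Longrightarrow> norm (integral {t..t + h} f - h *\<^sub>R f t) \<le> e * h"
      using N1(2)[OF \<open>t \<notin> N1\<close> \<open>e > 0\<close>] by blast
    obtain d2 where d2: "d2 > 0" "\<And>h. 0 < h \<Longrightarrow> h < d2 \<Longrightarrow>
        norm (integral {-t..-t + h} (\<lambda>x. f (-x)) - h *\<^sub>R f t) \<le> e * h"
      using N2(2)[OF \<open>-t \<notin> N2\<close> \<open>e > 0\<close>] by auto
    have "norm (y s - y t - (s - t) *\<^sub>R f t) \<le> e * norm (s - t)"
      if "norm (s - t) < Min {d1, d2, t}" for s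
    proof -
      have s: "\<bar>s - t\<bar> < d1" "\<bar>s - t\<bar> < d2" "\<bar>s - t\<bar> < t" using that by simp_all
      consider "s = t" | "s > t" | "s < t" by linarith
      then show ?thesis
      proof cases
        case 1
        then show ?thesis by simp
      next
        case 2
        have "norm (integral {t..t + (s - t)} f - (s - t) *\<^sub>R f t) \<le> e * (s - t)"
          using s(1) 2 by (intro d1(2)) simp_all
        moreover have "t + (s - t) = s" "norm (s - t) = s - t" using 2 by simp_all
        moreover have "y s - y t = integral {t..s} f" using y[of t s] 2 \<open>0 < t\<close> by simp
        ultimately show ?thesis by (simp only:)
      next
        case 3
        have int_eq: "integral {-t..-s} (\<lambda>x. f (-x)) = integral {s..t} f"
          by (rule Henstock_Kurzweil_Integration.integral_reflect_real)
        have "0 \<le> s" using s(3) 3 by simp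
        have "norm (integral {-t..-t + (t - s)} (\<lambda>x. f (-x)) - (t - s) *\<^sub>R f t) \<le> e * (t - s)"
          using s(2) 3 by (intro d2(2)) simp_all
        moreover note int_eq
        moreover have "-t + (t - s) = -s" by simp
        moreover have "y t - y s = integral {s..t} f" using y[of s t] 3 \<open>0 \<le> s\<close> by simp
        ultimately have "norm ((y t - y s) - (t - s) *\<^sub>R f t) \<le> e * (t - s)"
          by (simp only:)
        moreover have "(y t - y s) - (t - s) *\<^sub>R f t = - (y s - y t - (s - t) *\<^sub>R f t)"
          by (simp add: scaleR_diff_left)
        ultimately have "norm (y s - y t - (s - t) *\<^sub>R f t) \<le> e * (t - s)"
          by (simp only: norm_minus_cancel)
        moreover have "norm (s - t) = t - s" using 3 by simp
        ultimately show ?thesis by (simp only:)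
      qed
    qed
    then show "\<exists>d>0. \<forall>s. norm (s - t) < d \<longrightarrow> norm (y s - y t - (s - t) *\<^sub>R f t) \<le> e * norm (s - t)"
      using d1(1) d2(1) \<open>0 < t\<close> by (intro exI[of _ "Min {d1, d2, t}"] conjI allI impI) simp_all
  qed
  have "AE t in lebesgue. t \<notin> N" using neg negligible_iff_null_sets AE_not_in by blast
  then have "AE t in lborel. t \<notin> N" using AE_completion_iff by blast
  then show ?thesis by eventually_elim (use der in auto)
qed

section \<open>Trajectories of a controlled differential equation\<close>

locale controlled_ode =
  fixes U :: "'u::{metric_space, second_countable_topology} set"
    and f :: "'a::euclidean_space \<Rightarrow> 'u \<Rightarrow> 'a" and L A :: real
  assumes measurable_f: "(\<lambda>(y, u). f y u) \<in> borel_measurable (restrict_space borel (UNIV \<times> U))"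
    and L_nonneg: "0 \<le> L" and lipschitz: "u \<in> U \<Longrightarrow> norm (f y u - f y' u) \<le> L * norm (y - y')"
    and A_pos: "0 < A" and growth: "u \<in> U \<Longrightarrow> norm (f y u) \<le> A * (1 + norm y)"
begin

text \<open>Setting the velocity to \<open>0\<close> at negative times makes it integrable on every bounded interval.\<close>

definition velocity :: "(real \<Rightarrow> 'u) \<Rightarrow> (real \<Rightarrow> 'a) \<Rightarrow> real \<Rightarrow> 'a" where
  "velocity u z s = (if s < 0 then 0 else f (z s) (u s))"

definition solves :: "(real \<Rightarrow> 'u) \<Rightarrow> 'a \<Rightarrow> (real \<Rightarrow> 'a) \<Rightarrow> bool" where
  "solves u x y \<longleftrightarrow> continuous_on {0..} y \<and> (\<forall>t\<ge>0. y t = x + integral {0..t} (velocity u y))"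

lemma control_in: "u \<in> controls U \<Longrightarrow> 0 \<le> s \<Longrightarrow> u s \<in> U"
  unfolding controls_def by (drule measurable_space[of _ _ _ s]) (auto simp: space_restrict_space)

lemma velocity_measurable:
  assumes u: "u \<in> controls U" and z: "continuous_on {0..} z"
  shows "velocity u z \<in> borel_measurable borel"
proof -
  have z': "z \<in> borel_measurable (restrict_space borel {0..})"
    using z by (rule borel_measurable_continuous_on_restrict)
  have "u \<in> restrict_space borel {0..} \<rightarrow>\<^sub>M borel"
    using u unfolding controls_def by (simp add: measurable_restrict_space2_iff)
  then have "(\<lambda>s. (z s, u s)) \<in> restrict_space borel {0..} \<rightarrow>\<^sub>M borel"
    unfolding borel_prod[symmetric] using z' by (rule measurable_Pair[rotated])
  then have "(\<lambda>s. (z s, u s)) \<in> restrict_space borel {0..} \<rightarrow>\<^sub>M restrict_space borel (UNIV \<times> U)"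
    using control_in[OF u] by (intro measurable_restrict_space2) (auto simp: space_restrict_space)
  from measurable_compose[OF this measurable_f]
  have "(\<lambda>s. f (z s) (u s)) \<in> borel_measurable (restrict_space borel {0..})" by simp
  then have "(\<lambda>s. if s \<in> {0..} then f (z s) (u s) else 0) \<in> borel_measurable borel"
    by (subst (asm) measurable_restrict_space_iff[of _ _ 0]) auto
  also have "(\<lambda>s. if s \<in> {0..} then f (z s) (u s) else 0) = velocity u z"
    by (auto simp: velocity_def)
  finally show ?thesis .
qed

lemma velocity_norm_le:
  assumes u: "u \<in> controls U" and "norm (z s) \<le> B" "0 \<le> B"
  shows "norm (velocity u z s) \<le> A * (1 + B)"
proof (cases "s < 0")
  case True
  then show ?thesis using A_pos assms by (simp add: velocity_def)
next
  case False
  then have "norm (velocity u z s) \<le> A * (1 + norm (z s))"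
    using growth[OF control_in[OF u], of s "z s"] by (simp add: velocity_def)
  also have "\<dots> \<le> A * (1 + B)" using A_pos assms by (intro mult_left_mono) auto
  finally show ?thesis .
qed

lemma velocity_integrable:
  assumes u: "u \<in> controls U" and z: "continuous_on {0..} z"
  shows "velocity u z integrable_on {a..b}"
proof -
  have "compact (z ` {0..max 0 b})"
    using continuous_on_subset[OF z] by (intro compact_continuous_image) auto
  then have "\<exists>B>0. \<forall>s\<in>{0..max 0 b}. norm (z s) \<le> B"
    using compact_imp_bounded[of "z ` {0..max 0 b}"] by (simp add: bounded_pos)
  then obtain B where B: "0 < B" "\<And>s. s \<in> {0..max 0 b} \<Longrightarrow> norm (z s) \<le> B" by auto
  have bd: "norm (velocity u z s) \<le> A * (1 + B)" if "s \<in> {a..b}" for s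
  proof (cases "s < 0")
    case True
    then show ?thesis using A_pos B by (simp add: velocity_def)
  next
    case False
    then show ?thesis using that B by (intro velocity_norm_le[OF u]) auto
  qed
  have "set_integrable lborel {a..b} (velocity u z)"
    unfolding set_integrable_def
    by (intro integrableI_bounded_set_indicator[where B="A * (1 + B)"])
      (use bd velocity_measurable[OF u z] in \<open>auto simp: emeasure_lborel_Icc_eq\<close>)
  then show ?thesis by (rule set_borel_integral_eq_integral(1))
qed

lemma velocity_cong:
  assumes "\<And>s. s \<in> {a..<b} \<Longrightarrow> 0 \<le> s \<Longrightarrow> y s = z s" "\<And>s. s \<in> {a..<b} \<Longrightarrow> 0 \<le> s \<Longrightarrow> u s = v s"
  shows "integral {a..b} (velocity u y) = integral {a..b} (velocity v z)"
  by (rule integral_spike[of "{b}"]) (use assms in \<open>auto simp: velocity_def\<close>)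

text \<open>In the norm weighted by \<open>exp (- K * s)\<close> the integral operator of the equation contracts with
factor \<open>L / K\<close>, because integrating \<open>exp (K * s)\<close> divides it by \<open>K\<close>. Both uniqueness and existence
follow from this estimate with \<open>K > L\<close>.\<close>

lemma velocity_integral_contraction:
  assumes u: "u \<in> controls U" and y: "continuous_on {0..} y" and z: "continuous_on {0..} z"
    and K: "K > 0" and t: "t \<ge> 0"
    and le: "\<And>s. s \<in> {0..t} \<Longrightarrow> norm (y s - z s) \<le> m * exp (K * s)" and m: "m \<ge> 0"
  shows "norm (integral {0..t} (velocity u y) - integral {0..t} (velocity u z)) \<le> L / K * m * exp (K * t)"
proof -
  have exp_int: "((\<lambda>s. L * (m * exp (K * s))) has_integral (L * m / K * exp (K * t) - L * m / K * exp (K * 0))) {0..t}"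
    by (rule fundamental_theorem_of_calculus[OF t])
      (use K in \<open>auto intro!: derivative_eq_intros simp: has_real_derivative_iff_has_vector_derivative[symmetric]\<close>)
  have "norm (integral {0..t} (\<lambda>s. velocity u y s - velocity u z s)) \<le> integral {0..t} (\<lambda>s. L * (m * exp (K * s)))"
  proof (rule integral_norm_bound_integral)
    show "(\<lambda>s. velocity u y s - velocity u z s) integrable_on {0..t}"
      by (intro integrable_diff velocity_integrable u y z)
    show "(\<lambda>s. L * (m * exp (K * s))) integrable_on {0..t}" using exp_int by (rule has_integral_integrable)
    fix s assume s: "s \<in> {0..t}"
    then have "norm (velocity u y s - velocity u z s) \<le> L * norm (y s - z s)"
      using lipschitz[OF control_in[OF u]] by (simp add: velocity_def)
    also have "\<dots> \<le> L * (m * exp (K * s))" using le[OF s] L_nonneg by (rule mult_left_mono)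
    finally show "norm (velocity u y s - velocity u z s) \<le> L * (m * exp (K * s))" .
  qed
  also have "\<dots> = L * m / K * exp (K * t) - L * m / K * exp (K * 0)" using exp_int by (rule integral_unique)
  also have "\<dots> \<le> L / K * m * exp (K * t)" using L_nonneg m K by simp
  finally show ?thesis
    by (subst (asm) integral_diff) (intro velocity_integrable u y z)+
qed

lemma solves_unique:
  assumes u: "u \<in> controls U" and v: "v \<in> controls U" and uv: "\<And>s. s \<in> {0..<T} \<Longrightarrow> u s = v s"
    and y: "solves u x y" and z: "solves v x z" and t: "t \<in> {0..T}"
  shows "y t = z t"
proof -
  have yc: "continuous_on {0..} y" and zc: "continuous_on {0..} z"
    using y z by (auto simp: solves_def)
  define K where "K = L + 1"
  \<comment> \<open>the weighted distance attains its maximum \<open>d r\<close>, and the contraction bounds it by \<open>L / K * d r\<close>\<close>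
  define d where "d s = norm (y s - z s) * exp (- K * s)" for s
  have "continuous_on {0..T} d"
    unfolding d_def by (intro continuous_intros continuous_on_subset[OF yc] continuous_on_subset[OF zc]) auto
  then obtain r where r: "r \<in> {0..T}" "\<And>s. s \<in> {0..T} \<Longrightarrow> d s \<le> d r"
    using continuous_attains_sup[of "{0..T}" d] t by force
  have dr: "norm (y s - z s) = d s * exp (K * s)" for s by (simp add: d_def exp_minus)
  have zr: "z r = x + integral {0..r} (velocity u z)"
  proof -
    have "integral {0..r} (velocity v z) = integral {0..r} (velocity u z)"
      using uv r(1) by (intro velocity_cong) auto
    then show ?thesis using z r(1) by (auto simp: solves_def)
  qed
  have "d r * exp (K * r) = norm (integral {0..r} (velocity u y) - integral {0..r} (velocity u z))"
    using y r(1) zr by (simp add: dr[symmetric] solves_def)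
  also have "\<dots> \<le> L / K * d r * exp (K * r)"
  proof (rule velocity_integral_contraction[OF u yc zc])
    fix s assume "s \<in> {0..r}"
    then have "d s \<le> d r" using r by auto
    then show "norm (y s - z s) \<le> d r * exp (K * s)" by (simp add: dr)
  qed (use L_nonneg r in \<open>auto simp: K_def d_def\<close>)
  finally have "d r \<le> L / K * d r" by (rule mult_right_le_imp_le) simp
  then have "d r * (1 - L / K) \<le> 0" by (simp add: algebra_simps)
  moreover have "1 - L / K > 0" using L_nonneg by (simp add: K_def)
  ultimately have "d r \<le> 0" by (simp add: mult_le_0_iff)
  then have "d t \<le> 0" using r(2)[OF t] by simp
  then show ?thesis by (simp add: d_def mult_le_0_iff)
qed

text \<open>The fixed point is taken among the bounded continuous functions \<open>w\<close>, where \<open>exp (K * s) *\<^sub>R w s\<close> is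
the sought solution. Linear growth of \<open>f\<close> keeps the operator within the bounded functions, so that
one fixed point argument gives the solution on the whole half-line.\<close>

lemma solves_exists:
  assumes u: "u \<in> controls U"
  shows "\<exists>y. solves u x y"
proof -
  define K where "K = L + 1"
  have K: "K > 0" "L / K < 1" using L_nonneg by (auto simp: K_def)
  define E where "E w s = exp (K * s) *\<^sub>R apply_bcontfun w s" for w :: "real \<Rightarrow>\<^sub>C 'a" and s
  have E: "continuous_on {0..} (E w)" for w unfolding E_def by (intro continuous_intros) auto
  \<comment> \<open>the bounded continuous functions live on the whole line, so \<open>P w\<close> is extended to negative times by its value at \<open>0\<close>\<close>
  define P where "P w t = exp (- K * max 0 t) *\<^sub>R (x + integral {0..max 0 t} (velocity u (E w)))" for w t
  have P_cont: "continuous_on UNIV (P w)" for w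
  proof -
    have "isCont (\<lambda>t. integral {0..max 0 t} (velocity u (E w))) t" for t
    proof -
      define b where "b = \<bar>t\<bar> + 1"
      have "continuous_on {0..b} (\<lambda>t. integral {0..t} (velocity u (E w)))"
        by (intro indefinite_integral_continuous_1 velocity_integrable u E)
      then have "continuous_on {-b<..<b} ((\<lambda>t. integral {0..t} (velocity u (E w))) \<circ> max 0)"
        by (intro continuous_on_compose continuous_intros) (auto elim!: continuous_on_subset simp: b_def)
      then have "\<forall>s\<in>{-b<..<b}. isCont (\<lambda>t. integral {0..max 0 t} (velocity u (E w))) s"
        by (subst (asm) continuous_on_eq_continuous_at) (auto simp: o_def)
      moreover have "t \<in> {-b<..<b}" by (auto simp: b_def)
      ultimately show ?thesis by (rule bspec)
    qed
    then have "continuous_on UNIV (\<lambda>t. integral {0..max 0 t} (velocity u (E w)))"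
      by (simp add: continuous_at_imp_continuous_on)
    then show ?thesis unfolding P_def by (intro continuous_intros)
  qed
  have P_diff: "norm (P w t - P v t) \<le> L / K * dist w v" for w v t
  proof -
    let ?t = "max 0 t"
    have "norm (integral {0..?t} (velocity u (E w)) - integral {0..?t} (velocity u (E v)))
        \<le> L / K * dist w v * exp (K * ?t)"
    proof (rule velocity_integral_contraction[OF u E E])
      fix s
      have "norm (apply_bcontfun w s - apply_bcontfun v s) \<le> dist w v"
        using dist_bounded[of w s v] by (simp add: dist_norm)
      then show "norm (E w s - E v s) \<le> dist w v * exp (K * s)"
        by (simp add: E_def scaleR_diff_right[symmetric] mult.commute)
    qed (use K in auto)
    then have "exp (- K * ?t) * norm (integral {0..?t} (velocity u (E w)) - integral {0..?t} (velocity u (E v)))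
        \<le> exp (- K * ?t) * (L / K * dist w v * exp (K * ?t))" by (rule mult_left_mono) simp
    moreover have "P w t - P v t
        = exp (- K * ?t) *\<^sub>R (integral {0..?t} (velocity u (E w)) - integral {0..?t} (velocity u (E v)))"
      by (simp add: P_def scaleR_add_right scaleR_diff_right)
    moreover have "exp (- K * ?t) * (L / K * dist w v * exp (K * ?t)) = L / K * dist w v"
      by (simp add: exp_minus)
    ultimately show ?thesis by (simp only: norm_scaleR abs_exp_cancel)
  qed
  have P0: "bounded (range (P 0))"
  proof -
    have E0: "E 0 s = 0" for s by (simp add: E_def)
    have "norm (P 0 t) \<le> norm x + A / K" for t
    proof -
      let ?t = "max 0 t"
      have "norm (integral {0..?t} (velocity u (E 0))) \<le> A * ?t"
      proof -
        have "norm (velocity u (E 0) s) \<le> A" for s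
          using velocity_norm_le[OF u, of "E 0" s 0] E0 by simp
        then have "norm (integral {0..?t} (velocity u (E 0))) \<le> integral {0..?t} (\<lambda>_. A)"
          by (intro integral_norm_bound_integral velocity_integrable u E) auto
        then show ?thesis by (simp add: mult.commute)
      qed
      moreover have "A * ?t \<le> A / K * exp (K * ?t)"
        proof -
        have "K * ?t \<le> exp (K * ?t)" using exp_ge_add_one_self[of "K * ?t"] by linarith
        then have "A / K * (K * ?t) \<le> A / K * exp (K * ?t)"
          using A_pos K by (intro mult_left_mono) auto
        then show ?thesis using K by simp
      qed
      ultimately have "norm (x + integral {0..?t} (velocity u (E 0))) \<le> norm x + A / K * exp (K * ?t)"
        by (meson add_left_mono norm_triangle_le order_trans)
      also have "\<dots> \<le> (norm x + A / K) * exp (K * ?t)"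
      proof -
        have "norm x * 1 \<le> norm x * exp (K * ?t)" using K by (intro mult_left_mono) auto
        then show ?thesis by (simp add: distrib_right)
      qed
      finally have "exp (- K * ?t) * norm (x + integral {0..?t} (velocity u (E 0)))
          \<le> exp (- K * ?t) * ((norm x + A / K) * exp (K * ?t))" by (rule mult_left_mono) simp
      also have "\<dots> = norm x + A / K" by (simp add: exp_minus)
      finally show ?thesis by (simp add: P_def)
    qed
    then show ?thesis unfolding bounded_iff by blast
  qed
  have P_bcont: "P w \<in> bcontfun" for w
  proof -
    obtain B where B: "\<And>t. norm (P 0 t) \<le> B" using P0 by (auto simp: bounded_iff)
    have "norm (P w t) \<le> B + L / K * dist w 0" for t
      using P_diff[of w t 0] B[of t] norm_triangle_sub[of "P w t" "P 0 t"] by linarith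
    then show ?thesis using P_cont by (intro bcontfun_normI)
  qed
  define Q where "Q w = Bcontfun (P w)" for w
  have Q: "apply_bcontfun (Q w) = P w" for w
    unfolding Q_def by (rule Bcontfun_inverse[OF P_bcont])
  have "dist (Q w) (Q v) \<le> L / K * dist w v" for w v
    by (rule dist_bound, unfold Q, subst dist_norm, rule P_diff)
  then obtain w where w: "Q w = w"
    using banach_fix_type[of "L / K" Q] K L_nonneg by auto
  have "E w t = x + integral {0..t} (velocity u (E w))" if "t \<ge> 0" for t
  proof -
    have "apply_bcontfun w t = P w t" using Q[of w] w by simp
    then show ?thesis using that by (simp add: E_def[of w t] P_def exp_minus)
  qed
  then have "\<forall>t\<ge>0. E w t = x + integral {0..t} (velocity u (E w))" by (intro allI impI)
  with E[of w] have "solves u x (E w)" unfolding solves_def by (rule conjI)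
  then show ?thesis by (rule exI[of _ "E w"])
qed

lemma solves_integral:
  assumes u: "u \<in> controls U" and y: "solves u x y" and st: "0 \<le> s" "s \<le> t"
  shows "y t - y s = integral {s..t} (velocity u y)"
proof -
  have c: "continuous_on {0..} y" using y by (simp add: solves_def)
  have "integral {0..s} (velocity u y) + integral {s..t} (velocity u y) = integral {0..t} (velocity u y)"
    using st by (intro Henstock_Kurzweil_Integration.integral_combine velocity_integrable u c) auto
  moreover have "y s = x + integral {0..s} (velocity u y)" "y t = x + integral {0..t} (velocity u y)"
    using y st by (simp_all add: solves_def)
  ultimately show ?thesis by (simp add: algebra_simps)
qed

lemma solves_increment_le:
  assumes u: "u \<in> controls U" and y: "solves u x y" and st: "0 \<le> s" "s \<le> t"
    and B: "\<And>r. r \<in> {s..t} \<Longrightarrow> norm (y r) \<le> B" "0 \<le> B"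
  shows "norm (y t - y s) \<le> A * (1 + B) * (t - s)"
proof -
  have c: "continuous_on {0..} y" using y by (simp add: solves_def)
  have "norm (integral {s..t} (velocity u y)) \<le> integral {s..t} (\<lambda>_. A * (1 + B))"
    using B by (intro integral_norm_bound_integral velocity_integrable u c velocity_norm_le[OF u]) auto
  also have "\<dots> = A * (1 + B) * (t - s)" using st by simp
  finally show ?thesis by (simp add: solves_integral[OF u y st])
qed

lemma solves_imp_is_trajectory:
  assumes u: "u \<in> controls U" and y: "solves u x y"
  shows "is_trajectory f u x y"
  unfolding is_trajectory_def
proof (intro conjI allI impI)
  have c: "continuous_on {0..} y" using y by (simp add: solves_def)
  show "y 0 = x" using y by (simp add: solves_def)
  show "absolutely_continuous_on_interval 0 T y" if "0 \<le> T" for T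
    unfolding absolutely_continuous_on_interval_def
  proof (intro allI impI)
    fix e :: real assume "e > 0"
    have "compact (y ` {0..T})"
      using continuous_on_subset[OF c] by (intro compact_continuous_image) auto
    then have "\<exists>B>0. \<forall>s\<in>{0..T}. norm (y s) \<le> B"
      using compact_imp_bounded[of "y ` {0..T}"] by (simp add: bounded_pos)
    then obtain B where B: "0 < B" "\<And>s. s \<in> {0..T} \<Longrightarrow> norm (y s) \<le> B" by auto
    define C where "C = A * (1 + B)"
    have C: "C > 0" using A_pos B by (simp add: C_def)
    have inc: "norm (y t - y s) \<le> C * (t - s)" if "0 \<le> s" "s \<le> t" "t \<le> T" for s t
      unfolding C_def using that B by (intro solves_increment_le[OF u y]) auto
    show "\<exists>d>0. \<forall>D. finite D \<longrightarrow> (\<forall>(s, t)\<in>D. 0 \<le> s \<and> s \<le> t \<and> t \<le> T) \<longrightarrow>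
        disjoint_family_on (\<lambda>(s, t). {s<..<t}) D \<longrightarrow> (\<Sum>(s, t)\<in>D. t - s) < d \<longrightarrow>
        (\<Sum>(s, t)\<in>D. norm (y t - y s)) < e"
    proof (intro exI[of _ "e / C"] conjI allI impI)
      fix D :: "(real \<times> real) set"
      assume D: "\<forall>(s, t)\<in>D. 0 \<le> s \<and> s \<le> t \<and> t \<le> T" "(\<Sum>(s, t)\<in>D. t - s) < e / C"
      have "(\<Sum>(s, t)\<in>D. norm (y t - y s)) \<le> (\<Sum>(s, t)\<in>D. C * (t - s))"
        using D(1) inc by (intro sum_mono) (simp add: split_beta)
      also have "\<dots> = C * (\<Sum>(s, t)\<in>D. t - s)" by (simp add: sum_distrib_left split_beta)
      also have "\<dots> < e" using D(2) C by (simp add: field_simps)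
      finally show "(\<Sum>(s, t)\<in>D. norm (y t - y s)) < e" .
    qed (use \<open>e > 0\<close> C in simp)
  qed
  have "AE t in lborel. 0 < t \<longrightarrow> (y has_vector_derivative velocity u y t) (at t)"
    by (intro AE_indefinite_integral_has_vector_derivative velocity_integrable[OF u c] solves_integral[OF u y])
  then show "AE t in lborel. 0 < t \<longrightarrow> (y has_vector_derivative f (y t) (u t)) (at t)"
    by eventually_elim (simp add: velocity_def)
qed

lemma is_trajectory_imp_solves:
  assumes u: "u \<in> controls U" and y: "is_trajectory f u x y"
  shows "solves u x y"
proof -
  have ac: "absolutely_continuous_on_interval 0 T y" if "T \<ge> 0" for T
    using y that by (simp add: is_trajectory_def)
  have c: "continuous_on {0..} y"
    unfolding continuous_on_iff
  proof (intro ballI allI impI)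
    fix x e :: real assume x: "x \<in> {0..}" and "e > 0"
    obtain d where d: "d > 0" and dd: "\<forall>D. finite D \<longrightarrow> (\<forall>(s, t)\<in>D. 0 \<le> s \<and> s \<le> t \<and> t \<le> x + 1) \<longrightarrow>
        disjoint_family_on (\<lambda>(s, t). {s<..<t}) D \<longrightarrow> (\<Sum>(s, t)\<in>D. t - s) < d \<longrightarrow>
        (\<Sum>(s, t)\<in>D. norm (y t - y s)) < e"
      using ac[of "x + 1", unfolded absolutely_continuous_on_interval_def, rule_format, OF _ \<open>e > 0\<close>] x by auto
    have "dist (y x') (y x) < e" if x': "x' \<in> {0..}" "dist x' x < min d 1" for x'
    proof -
      have "(\<Sum>(s, t)\<in>{(min x x', max x x')}. norm (y t - y s)) < e"
        by (rule dd[rule_format])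
          (use x x' in \<open>auto simp: dist_real_def disjoint_family_on_def min_def max_def split: if_splits\<close>)
      then show ?thesis by (auto simp: dist_norm min_def max_def norm_minus_commute split: if_splits)
    qed
    then show "\<exists>d>0. \<forall>x'\<in>{0..}. dist x' x < d \<longrightarrow> dist (y x') (y x) < e"
      using d by (intro exI[of _ "min d 1"]) auto
  qed
  have "AE t in lborel. 0 < t \<longrightarrow> (y has_vector_derivative velocity u y t) (at t)"
    using y by (auto simp: is_trajectory_def velocity_def elim!: eventually_mono)
  then have "AE t in lebesgue. 0 < t \<longrightarrow> (y has_vector_derivative velocity u y t) (at t)"
    by (rule AE_completion)
  then obtain N where N: "N \<in> null_sets lebesgue"
      "\<And>t. t \<notin> N \<Longrightarrow> 0 < t \<Longrightarrow> (y has_vector_derivative velocity u y t) (at t)"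
    by (auto simp: eventually_ae_filter)
  have "y t = x + integral {0..t} (velocity u y)" if "t \<ge> 0" for t
  proof -
    have "(velocity u y has_integral (y t - y 0)) {0..t}"
    proof (rule absolutely_continuous_has_integral[OF that ac[OF that]])
      show "negligible (insert 0 N)" using N(1) negligible_iff_null_sets by (metis negligible_insert)
      fix s assume "s \<in> {0..t} - insert 0 N"
      then have "s \<notin> N" "0 < s" by auto
      from N(2)[OF this] show "(y has_vector_derivative velocity u y s) (at s within {0..t})"
        by (rule has_vector_derivative_at_within)
    qed
    then have "integral {0..t} (velocity u y) = y t - y 0" by (rule integral_unique)
    moreover have "y 0 = x" using y by (simp add: is_trajectory_def)
    ultimately show ?thesis by simp
  qed
  with c show ?thesis unfolding solves_def by (intro conjI allI impI)
qed

lemma trajectory_solves: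
  assumes u: "u \<in> controls U"
  shows "solves u x (trajectory f u x)"
proof -
  obtain y where "solves u x y" using solves_exists[OF u] by metis
  then have "is_trajectory f u x y" by (rule solves_imp_is_trajectory[OF u])
  then have "is_trajectory f u x (trajectory f u x)" 
    unfolding trajectory_def by (rule someI[where P = "is_trajectory f u x"])
  then show ?thesis by (rule is_trajectory_imp_solves[OF u])
qed

lemma trajectory_0: "u \<in> controls U \<Longrightarrow> trajectory f u x 0 = x"
  using trajectory_solves[of u x] by (simp add: solves_def)

lemma trajectory_continuous: "u \<in> controls U \<Longrightarrow> continuous_on {0..} (trajectory f u x)"
  using trajectory_solves[of u x] by (simp add: solves_def)

lemma trajectory_cong:
  assumes "u \<in> controls U" "v \<in> controls U" "\<And>s. s \<in> {0..<T} \<Longrightarrow> u s = v s" "t \<in> {0..T}"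
  shows "trajectory f u x t = trajectory f v x t"
  by (rule solves_unique[OF assms(1,2,3) trajectory_solves[OF assms(1)] trajectory_solves[OF assms(2)] assms(4)])

lemma control_shift:
  assumes u: "u \<in> controls U" and s: "0 \<le> s"
  shows "(\<lambda>t. u (s + t)) \<in> controls U"
proof -
  have "(\<lambda>t. s + t) \<in> restrict_space borel {0..} \<rightarrow>\<^sub>M restrict_space borel {0::real..}"
    using s by (intro measurable_restrict_space2 measurable_restrict_space1) (auto simp: space_restrict_space)
  then show ?thesis using u unfolding controls_def by (rule measurable_compose)
qed

lemma trajectory_shift:
  assumes u: "u \<in> controls U" and s: "0 \<le> s" and t: "0 \<le> t"
  shows "trajectory f u x (s + t) = trajectory f (\<lambda>r. u (s + r)) (trajectory f u x s) t"
proof -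
  define y where "y = trajectory f u x"
  note y = trajectory_solves[OF u, of x, folded y_def]
  have c: "continuous_on {0..} y" using y by (simp add: solves_def)
  have "solves (\<lambda>r. u (s + r)) (y s) (\<lambda>r. y (s + r))"
    unfolding solves_def
  proof (intro conjI allI impI)
    have "continuous_on {0..} (y \<circ> (\<lambda>r. s + r))"
      using s by (intro continuous_on_compose continuous_intros) (auto intro: continuous_on_subset[OF c])
    then show "continuous_on {0..} (\<lambda>r. y (s + r))" by (simp add: o_def)
    fix r :: real assume r: "0 \<le> r"
    have "(velocity u y has_integral (y (s + r) - y s)) (cbox s (s + r))"
      using solves_integral[OF u y s, of "s + r"] velocity_integrable[OF u c, of s "s + r"] r
      by (simp add: integrable_integral)
    from has_integral_affinity[OF this, of 1 s] 
    have "((\<lambda>q. velocity u y (s + q)) has_integral (y (s + r) - y s)) {0..r}"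
      using r by (simp add: add.commute)
    then have "((\<lambda>q. velocity (\<lambda>r. u (s + r)) (\<lambda>r. y (s + r)) q) has_integral (y (s + r) - y s)) {0..r}"
      by (rule has_integral_eq[rotated]) (use s in \<open>auto simp: velocity_def\<close>)
    then show "y (s + r) = y s + integral {0..r} (velocity (\<lambda>r. u (s + r)) (\<lambda>r. y (s + r)))"
      by (simp add: integral_unique)
  qed
  from solves_unique[OF control_shift[OF u s] control_shift[OF u s] refl this trajectory_solves[OF control_shift[OF u s]], of t t]
  show ?thesis using t by (simp add: y_def)
qed

lemma const_control: "b \<in> U \<Longrightarrow> (\<lambda>_. b) \<in> controls U"
  unfolding controls_def by (intro measurable_const) (simp add: space_restrict_space)

lemma control_switch:
  assumes v: "v \<in> controls U" and w: "w \<in> controls U" and T: "0 \<le> T"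
  shows "(\<lambda>t. if t < T then v t else w (t - T)) \<in> controls U"
proof -
  have shift: "(\<lambda>t. max 0 (t - T)) \<in> restrict_space borel {0..} \<rightarrow>\<^sub>M restrict_space borel {0::real..}"
    by (intro measurable_restrict_space2 measurable_restrict_space1) (auto simp: space_restrict_space)
  have "(\<lambda>t. if t < T then v t else w (max 0 (t - T))) \<in> controls U"
    unfolding controls_def
  proof (rule measurable_If)
    show "v \<in> restrict_space borel {0..} \<rightarrow>\<^sub>M restrict_space borel U"
      using v by (simp add: controls_def)
    show "(\<lambda>t. w (max 0 (t - T))) \<in> restrict_space borel {0..} \<rightarrow>\<^sub>M restrict_space borel U"
      using measurable_compose[OF shift] w by (simp add: controls_def)
    have "{t \<in> space (restrict_space borel {0::real..}). t < T} = {0..<T}"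
      by (auto simp: space_restrict_space)
    then show "{t \<in> space (restrict_space borel {0::real..}). t < T} \<in> sets (restrict_space borel {0..})"
      by (simp add: sets_restrict_space_iff) auto
  qed
  also have "(\<lambda>t. if t < T then v t else w (max 0 (t - T))) = (\<lambda>t. if t < T then v t else w (t - T))"
    by (auto simp: max_def)
  finally show ?thesis .
qed

text \<open>Up to time \<open>T\<close> the control \<open>vw\<close> agrees with \<open>v\<close>, and its shift by \<open>T\<close> agrees with \<open>w\<close>; a trajectory is
determined by its initial state and the control.\<close>

lemma trajectory_switch:
  assumes v: "v \<in> controls U" and w: "w \<in> controls U" and T: "0 \<le> T"
  defines "vw \<equiv> \<lambda>t. if t < T then v t else w (t - T)"
  shows "0 \<le> t \<Longrightarrow> t \<le> T \<Longrightarrow> trajectory f vw x t = trajectory f v x t"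
    and "0 \<le> t \<Longrightarrow> trajectory f vw x (T + t) = trajectory f w (trajectory f v x T) t"
proof -
  have c: "vw \<in> controls U" unfolding vw_def by (rule control_switch[OF v w T])
  show first: "trajectory f vw x t = trajectory f v x t" if "0 \<le> t" "t \<le> T" for t
    by (rule trajectory_cong[OF c v, of T]) (use that in \<open>auto simp: vw_def\<close>)
  assume t: "0 \<le> t"
  have "trajectory f vw x (T + t) = trajectory f (\<lambda>r. vw (T + r)) (trajectory f v x T) t"
    using trajectory_shift[OF c T t] first[of T] T by simp
  also have "\<dots> = trajectory f w (trajectory f v x T) t"
    by (rule trajectory_cong[OF control_shift[OF c T] w, of t]) (use t in \<open>auto simp: vw_def\<close>)
  finally show "trajectory f vw x (T + t) = trajectory f w (trajectory f v x T) t" .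
qed

end

section \<open>Following a nearby trajectory without losing distance\<close>

text \<open>The property \<open>response\<close> is how nonexpansiveness is used: at a pair of states \<open>y\<close>, \<open>z\<close> a single action
\<open>b\<close> at \<open>z\<close> answers all actions \<open>a\<close> at \<open>y\<close>. It can be chosen independently of \<open>a\<close>, because the scalar
product separates into a term with \<open>a\<close> and a term with \<open>b\<close>.\<close>

locale nonexpansive_ode = controlled_ode U f L A
  for U :: "'u::{metric_space, second_countable_topology} set"
    and f :: "'a::euclidean_space \<Rightarrow> 'u \<Rightarrow> 'a" and L A :: real +
  fixes Y :: "'a set"
  assumes Y_compact: "compact Y"
    and invariant: "x \<in> Y \<Longrightarrow> u \<in> controls U \<Longrightarrow> 0 \<le> t \<Longrightarrow> trajectory f u x t \<in> Y"
    and response: "U \<noteq> {} \<Longrightarrow> 0 < \<epsilon> \<Longrightarrow>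
      \<exists>b\<in>U. \<forall>a\<in>U. (y - z) \<bullet> f y a \<le> (y - z) \<bullet> f z b + \<epsilon>"
begin

lemma speed_bound:
  obtains R F where "0 < R" "0 < F" "\<And>x. x \<in> Y \<Longrightarrow> norm x \<le> R"
    "\<And>u x s t. u \<in> controls U \<Longrightarrow> x \<in> Y \<Longrightarrow> 0 \<le> s \<Longrightarrow> s \<le> t \<Longrightarrow>
       norm (trajectory f u x t - trajectory f u x s) \<le> F * (t - s)"
proof -
  obtain R where R: "0 < R" "\<And>x. x \<in> Y \<Longrightarrow> norm x \<le> R"
    using compact_imp_bounded[OF Y_compact] by (auto simp: bounded_pos)
  show thesis
  proof (rule that[of R "A * (1 + R)"])
    fix u x s t assume *: "u \<in> controls U" "x \<in> Y" "0 \<le> s" "s \<le> (t::real)"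
    show "norm (trajectory f u x t - trajectory f u x s) \<le> A * (1 + R) * (t - s)"
      by (rule solves_increment_le[OF *(1) trajectory_solves[OF *(1)] *(3,4)])
        (use * R invariant in auto)
  qed (use R A_pos in auto)
qed

text \<open>First-order estimate of the displacement in direction \<open>p\<close>: up to the Lipschitz error the velocity
may be evaluated at the initial state \<open>x\<close>.\<close>

lemma inner_velocity_bound:
  assumes u: "u \<in> controls U" and x: "x \<in> Y" and s: "0 \<le> s"
    and F: "\<And>r. r \<in> {0..s} \<Longrightarrow> norm (trajectory f u x r - x) \<le> d"
    and c: "\<And>r. r \<in> {0..s} \<Longrightarrow> p \<bullet> f x (u r) \<le> c"
  shows "p \<bullet> (trajectory f u x s - x) \<le> (c + norm p * L * d) * s"
proof -
  let ?y = "trajectory f u x"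
  note y = trajectory_solves[OF u, of x]
  note yc = trajectory_continuous[OF u, of x]
  have "p \<bullet> (?y s - x) = p \<bullet> integral {0..s} (velocity u ?y)"
    using solves_integral[OF u y, of 0 s] s trajectory_0[OF u, of x] by simp
  also have "\<dots> = integral {0..s} (\<lambda>r. p \<bullet> velocity u ?y r)"
    using integral_linear[OF velocity_integrable[OF u yc, of 0 s] bounded_linear_inner_right[of p]]
    by (simp add: o_def)
  also have "\<dots> \<le> integral {0..s} (\<lambda>r. c + norm p * L * d)"
  proof (rule integral_le)
    show "(\<lambda>r. p \<bullet> velocity u ?y r) integrable_on {0..s}"
      using integrable_linear[OF velocity_integrable[OF u yc, of 0 s] bounded_linear_inner_right[of p]]
      by (simp add: o_def)
    fix r assume r: "r \<in> {0..s}"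
    then have ur: "u r \<in> U" using control_in[OF u] by auto
    have "p \<bullet> velocity u ?y r = p \<bullet> f x (u r) + p \<bullet> (f (?y r) (u r) - f x (u r))"
      using r by (simp add: velocity_def inner_diff_right)
    also have "\<dots> \<le> c + norm p * (L * d)"
    proof (rule add_mono[OF c[OF r]])
      have "p \<bullet> (f (?y r) (u r) - f x (u r)) \<le> norm p * norm (f (?y r) (u r) - f x (u r))"
        by (rule norm_cauchy_schwarz)
      also have "\<dots> \<le> norm p * (L * norm (?y r - x))"
        using lipschitz[OF ur] by (intro mult_left_mono) auto
      also have "\<dots> \<le> norm p * (L * d)"
        using F[OF r] L_nonneg by (intro mult_left_mono) auto
      finally show "p \<bullet> (f (?y r) (u r) - f x (u r)) \<le> norm p * (L * d)" .
    qed
    finally show "p \<bullet> velocity u ?y r \<le> c + norm p * L * d" by (simp add: mult.assoc)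
  qed auto
  also have "\<dots> = (c + norm p * L * d) * s" using s by simp
  finally show ?thesis .
qed

text \<open>Expanding the squared distance, the first-order term is at most \<open>\<epsilon> * s\<close> by the choice of \<open>b\<close>, and all
other terms are of order \<open>s\<^sup>2\<close> since speeds are bounded on \<open>Y\<close>.\<close>

lemma short_time_response:
  obtains C where "0 \<le> C"
    "\<And>u x x' \<epsilon>. u \<in> controls U \<Longrightarrow> x \<in> Y \<Longrightarrow> x' \<in> Y \<Longrightarrow> 0 < \<epsilon> \<Longrightarrow>
      \<exists>b\<in>U. \<forall>s\<ge>0. (norm (trajectory f u x s - trajectory f (\<lambda>_. b) x' s))\<^sup>2
        \<le> (norm (x - x'))\<^sup>2 + \<epsilon> * s + C * s\<^sup>2"
proof -
  obtain R F where RF: "0 < R" "0 < F" "\<And>x. x \<in> Y \<Longrightarrow> norm x \<le> R"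
    "\<And>u x s t. u \<in> controls U \<Longrightarrow> x \<in> Y \<Longrightarrow> 0 \<le> s \<Longrightarrow> s \<le> t \<Longrightarrow>
       norm (trajectory f u x t - trajectory f u x s) \<le> F * (t - s)"
    using speed_bound by metis
  define C where "C = 8 * R * L * F + 4 * F\<^sup>2"
  show thesis
  proof (rule that[of C])
    show "0 \<le> C" using RF L_nonneg by (simp add: C_def)
    fix u x x' and \<epsilon> :: real
    assume u: "u \<in> controls U" and x: "x \<in> Y" and x': "x' \<in> Y" and \<epsilon>: "0 < \<epsilon>"
    define p where "p = x - x'"
    have "U \<noteq> {}" using control_in[OF u, of 0] by auto
    then obtain b where b: "b \<in> U" "\<And>a. a \<in> U \<Longrightarrow> p \<bullet> f x a \<le> p \<bullet> f x' b + \<epsilon> / 2"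
      using response[of "\<epsilon> / 2" x x'] \<epsilon> by (auto simp: p_def)
    let ?y = "trajectory f u x" and ?z = "trajectory f (\<lambda>_. b) x'"
    note bc = const_control[OF b(1)]
    have p: "norm p \<le> 2 * R" using RF(3)[OF x] RF(3)[OF x'] norm_triangle_ineq4[of x x'] by (simp add: p_def)
    have "(norm (?y s - ?z s))\<^sup>2 \<le> (norm (x - x'))\<^sup>2 + \<epsilon> * s + C * s\<^sup>2" if s: "0 \<le> s" for s
    proof -
      define I where "I = ?y s - x"
      define J where "J = ?z s - x'"
      have near: "norm (trajectory f v z r - z) \<le> F * s"
        if "v \<in> controls U" "z \<in> Y" "r \<in> {0..s}" for v z r
      proof -
        have "norm (trajectory f v z r - z) \<le> F * r"
          using RF(4)[OF that(1,2), of 0 r] that by (simp add: trajectory_0)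
        also have "\<dots> \<le> F * s" using that RF by auto
        finally show ?thesis .
      qed
      have Ip: "p \<bullet> I \<le> (p \<bullet> f x' b + \<epsilon> / 2 + norm p * L * (F * s)) * s"
        unfolding I_def using control_in[OF u] b(2)
        by (intro inner_velocity_bound[OF u x s near[OF u x]]) auto
      have Jp: "(- p) \<bullet> J \<le> ((- p) \<bullet> f x' b + norm (- p) * L * (F * s)) * s"
        unfolding J_def by (rule inner_velocity_bound[OF bc x' s near[OF bc x']]) auto
      have "p \<bullet> (I - J) \<le> \<epsilon> / 2 * s + 2 * L * F * s\<^sup>2 * norm p"
        using Ip Jp by (simp add: inner_diff_right algebra_simps power2_eq_square)
      also have "\<dots> \<le> \<epsilon> / 2 * s + 2 * L * F * s\<^sup>2 * (2 * R)"
        using p L_nonneg RF by (intro add_left_mono mult_left_mono) auto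
      finally have pIJ: "2 * (p \<bullet> (I - J)) \<le> \<epsilon> * s + 8 * R * L * F * s\<^sup>2" by (simp add: algebra_simps)
      have "norm (I - J) \<le> 2 * F * s"
        using near[OF u x, of s] near[OF bc x', of s] s norm_triangle_ineq4[of I J]
        by (simp add: I_def J_def)
      then have IJ: "(norm (I - J))\<^sup>2 \<le> 4 * F\<^sup>2 * s\<^sup>2"
        using power_mono[of "norm (I - J)" "2 * F * s" 2] by (simp add: power_mult_distrib)
      have "?y s - ?z s = p + (I - J)" by (simp add: p_def I_def J_def)
      then have "(norm (?y s - ?z s))\<^sup>2 = (norm p)\<^sup>2 + 2 * (p \<bullet> (I - J)) + (norm (I - J))\<^sup>2"
        by (simp add: power2_norm_eq_inner inner_add_left inner_add_right inner_commute)
      also have "\<dots> \<le> (norm p)\<^sup>2 + \<epsilon> * s + C * s\<^sup>2"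
        using pIJ IJ by (simp add: C_def algebra_simps)
      finally show ?thesis by (simp add: p_def)
    qed
    then show "\<exists>b\<in>U. \<forall>s\<ge>0. (norm (?y s - trajectory f (\<lambda>_. b) x' s))\<^sup>2
        \<le> (norm (x - x'))\<^sup>2 + \<epsilon> * s + C * s\<^sup>2"
      using b(1) by blast
  qed
qed

text \<open>The action of the follower is renewed at the multiples of \<open>h\<close>. An interval of length \<open>h\<close> costs
\<open>\<epsilon> * h + C * h\<^sup>2\<close>, so the errors add up to \<open>(\<epsilon> + C * h) * t\<close>.\<close>

lemma sampled_response:
  obtains C where "0 \<le> C"
    "\<And>u x x' \<epsilon> h n. u \<in> controls U \<Longrightarrow> x \<in> Y \<Longrightarrow> x' \<in> Y \<Longrightarrow> 0 < \<epsilon> \<Longrightarrow> 0 \<le> h \<Longrightarrow>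
      \<exists>v\<in>controls U. \<forall>t\<in>{0..real n * h}. (norm (trajectory f u x t - trajectory f v x' t))\<^sup>2
        \<le> (norm (x - x'))\<^sup>2 + (\<epsilon> + C * h) * t"
proof -
  obtain C where C: "0 \<le> C"
    "\<And>u x x' \<epsilon>. u \<in> controls U \<Longrightarrow> x \<in> Y \<Longrightarrow> x' \<in> Y \<Longrightarrow> 0 < \<epsilon> \<Longrightarrow>
      \<exists>b\<in>U. \<forall>s\<ge>0. (norm (trajectory f u x s - trajectory f (\<lambda>_. b) x' s))\<^sup>2
        \<le> (norm (x - x'))\<^sup>2 + \<epsilon> * s + C * s\<^sup>2"
    using short_time_response by metis
  show thesis
  proof (rule that[OF C(1)])
    fix u x x' and \<epsilon> h :: real and n
    assume u: "u \<in> controls U" and x: "x \<in> Y" and x': "x' \<in> Y" and \<epsilon>: "0 < \<epsilon>" and h: "0 \<le> h"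
    let ?g = "\<lambda>t. (norm (x - x'))\<^sup>2 + (\<epsilon> + C * h) * t"
    show "\<exists>v\<in>controls U. \<forall>t\<in>{0..real n * h}.
        (norm (trajectory f u x t - trajectory f v x' t))\<^sup>2 \<le> ?g t"
    proof (induction n)
      case 0
      show ?case using u by (intro bexI[of _ u]) (auto simp: trajectory_0)
    next
      case (Suc n)
      then obtain v where v: "v \<in> controls U"
        "\<And>t. t \<in> {0..real n * h} \<Longrightarrow> (norm (trajectory f u x t - trajectory f v x' t))\<^sup>2 \<le> ?g t"
        by auto
      define T where "T = real n * h"
      have T: "0 \<le> T" using h by (simp add: T_def)
      define z where "z = trajectory f u x T"
      define z' where "z' = trajectory f v x' T"
      have zY: "z \<in> Y" "z' \<in> Y" unfolding z_def z'_def using u v x x' T invariant by auto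
      obtain b where b: "b \<in> U" "\<And>s. 0 \<le> s \<Longrightarrow>
          (norm (trajectory f (\<lambda>r. u (T + r)) z s - trajectory f (\<lambda>_. b) z' s))\<^sup>2
            \<le> (norm (z - z'))\<^sup>2 + \<epsilon> * s + C * s\<^sup>2"
        using C(2)[OF control_shift[OF u T] zY \<epsilon>] by auto
      define w where "w = (\<lambda>t. if t < T then v t else b)"
      have w: "w \<in> controls U"
        unfolding w_def by (rule control_switch[OF v(1) const_control[OF b(1)] T])
      have w1: "trajectory f w x' t = trajectory f v x' t" if "0 \<le> t" "t \<le> T" for t
        unfolding w_def by (rule trajectory_switch(1)[OF v(1) const_control[OF b(1)] T that])
      have w2: "trajectory f w x' (T + s) = trajectory f (\<lambda>_. b) z' s" if "0 \<le> s" for s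
        unfolding w_def z'_def by (rule trajectory_switch(2)[OF v(1) const_control[OF b(1)] T that])
      have "(norm (trajectory f u x t - trajectory f w x' t))\<^sup>2 \<le> ?g t"
        if t: "t \<in> {0..real (Suc n) * h}" for t
      proof (cases "t \<le> T")
        case True
        then show ?thesis using v(2)[of t] w1[of t] t by (simp add: T_def)
      next
        case False
        define s where "s = t - T"
        have s: "0 \<le> s" "s \<le> h" "t = T + s" using False t by (auto simp: s_def T_def algebra_simps)
        have "(norm (trajectory f u x t - trajectory f w x' t))\<^sup>2
            = (norm (trajectory f (\<lambda>r. u (T + r)) z s - trajectory f (\<lambda>_. b) z' s))\<^sup>2"
          using s(1) by (simp add: s(3) w2 trajectory_shift[OF u T s(1)] z_def)
        also have "\<dots> \<le> (norm (z - z'))\<^sup>2 + \<epsilon> * s + C * s\<^sup>2" by (rule b(2)[OF s(1)])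
        also have "(norm (z - z'))\<^sup>2 \<le> ?g T" unfolding z_def z'_def by (rule v(2)) (use T in \<open>auto simp: T_def\<close>)
        also have "C * s\<^sup>2 \<le> C * (h * s)"
          using C(1) s by (intro mult_left_mono) (auto simp: power2_eq_square mult_right_mono)
        finally show ?thesis by (simp add: s(3) algebra_simps)
      qed
      with w show ?case by blast
    qed
  qed
qed

text \<open>The strict inequality leaves a gap that absorbs the sampling error. As the radius \<open>\<rho>\<close> is
preserved exactly, the statement can be iterated over infinitely many unit intervals without loss.\<close>

lemma unit_time_response:
  assumes u: "u \<in> controls U" and x: "x \<in> Y" and x': "x' \<in> Y" and \<rho>: "norm (x - x') < \<rho>"
  shows "\<exists>v\<in>controls U. \<forall>t\<in>{0..1}. norm (trajectory f u x t - trajectory f v x' t) < \<rho>"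
proof -
  obtain C where C: "0 \<le> C"
    "\<And>u x x' \<epsilon> h n. u \<in> controls U \<Longrightarrow> x \<in> Y \<Longrightarrow> x' \<in> Y \<Longrightarrow> 0 < \<epsilon> \<Longrightarrow> 0 \<le> h \<Longrightarrow>
      \<exists>v\<in>controls U. \<forall>t\<in>{0..real n * h}. (norm (trajectory f u x t - trajectory f v x' t))\<^sup>2
        \<le> (norm (x - x'))\<^sup>2 + (\<epsilon> + C * h) * t"
    using sampled_response by metis
  define gap where "gap = \<rho>\<^sup>2 - (norm (x - x'))\<^sup>2"
  have gap: "gap > 0" using \<rho> by (simp add: gap_def power_strict_mono)
  obtain n where n: "C / (gap / 4) < real n" using reals_Archimedean2 by blast
  have n0: "0 < real n" using C(1) gap n by (metis divide_nonneg_pos le_less_trans zero_less_divide_iff zero_less_numeral)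
  define h where "h = 1 / real n"
  have h: "0 \<le> h" "real n * h = 1" "C * h < gap / 4"
    using n n0 gap by (auto simp: h_def field_simps)
  obtain v where v: "v \<in> controls U"
    "\<And>t. t \<in> {0..1} \<Longrightarrow> (norm (trajectory f u x t - trajectory f v x' t))\<^sup>2
        \<le> (norm (x - x'))\<^sup>2 + (gap / 4 + C * h) * t"
    using C(2)[OF u x x', of "gap / 4" h n] gap h by auto
  have "norm (trajectory f u x t - trajectory f v x' t) < \<rho>" if t: "t \<in> {0..1}" for t
  proof -
    have "(gap / 4 + C * h) * t \<le> (gap / 4 + C * h) * 1"
      using t gap C(1) h by (intro mult_left_mono) auto
    also have "\<dots> < gap" using h gap by simp
    finally have "(norm (trajectory f u x t - trajectory f v x' t))\<^sup>2 < \<rho>\<^sup>2"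
      using v(2)[OF t] by (simp add: gap_def)
    then show ?thesis using \<rho> by (meson norm_ge_zero order_le_less_trans power2_less_imp_less less_imp_le)
  qed
  with v(1) show ?thesis by blast
qed

end

section \<open>Deterministic dynamic programs with nonexpansive transitions\<close>

text \<open>The relation \<open>step x r y\<close> says that one can move from \<open>x\<close> to \<open>y\<close> at cost \<open>r\<close>. In \<open>step_track\<close> the radius
\<open>\<rho>\<close> is quantified after \<open>d\<close> and is the same before and after the move. Therefore imitation does not
lose distance along a play, however long.\<close>

locale dynamic_program =
  fixes X :: "'s::metric_space set" and step :: "'s \<Rightarrow> real \<Rightarrow> 's \<Rightarrow> bool" and M :: real
  assumes X_compact: "compact X"
    and step_in: "x \<in> X \<Longrightarrow> step x r y \<Longrightarrow> y \<in> X"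
    and step_cost: "x \<in> X \<Longrightarrow> step x r y \<Longrightarrow> \<bar>r\<bar> \<le> M"
    and step_track: "0 < e \<Longrightarrow> \<exists>d>0. \<forall>x\<in>X. \<forall>x'\<in>X. \<forall>r y \<rho>. step x r y \<longrightarrow> dist x x' < \<rho> \<longrightarrow> \<rho> \<le> d \<longrightarrow>
      (\<exists>r' y'. step x' r' y' \<and> dist y y' < \<rho> \<and> \<bar>r - r'\<bar> \<le> e)"
begin

fun play :: "'s \<Rightarrow> real list \<Rightarrow> 's \<Rightarrow> bool" where
  "play x [] y \<longleftrightarrow> y = x"
| "play x (r # rs) y \<longleftrightarrow> (\<exists>z. step x r z \<and> play z rs y)"

lemma play_append: "play x (rs @ ss) y \<longleftrightarrow> (\<exists>z. play x rs z \<and> play z ss y)"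
  by (induction rs arbitrary: x) auto

lemma play_in: "x \<in> X \<Longrightarrow> play x rs y \<Longrightarrow> y \<in> X"
  by (induction rs arbitrary: x) (auto intro: step_in)

lemma play_cost: "x \<in> X \<Longrightarrow> play x rs y \<Longrightarrow> \<bar>sum_list rs\<bar> \<le> M * length rs"
proof (induction rs arbitrary: x)
  case (Cons r rs)
  then obtain z where "step x r z" "play z rs y" by auto
  then show ?case using Cons.IH[of z] step_cost[of x r z] step_in[of x r z] Cons.prems
    by (simp add: algebra_simps)
qed auto

text \<open>This is \<open>step_track\<close> iterated along plays. All partial sums of the costs are compared, not only the
total, so that imitation preserves bounds on partial averages.\<close>

definition trackable :: "real \<Rightarrow> real \<Rightarrow> bool" where
  "trackable e d \<longleftrightarrow> 0 < d \<and> (\<forall>\<rho>\<le>d. \<forall>x\<in>X. \<forall>x'\<in>X. \<forall>rs y. dist x x' < \<rho> \<longrightarrow> play x rs y \<longrightarrow>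
     (\<exists>rs' y'. play x' rs' y' \<and> dist y y' < \<rho> \<and> length rs' = length rs \<and>
        (\<forall>n. sum_list (take n rs') \<le> sum_list (take n rs) + e * min n (length rs))))"

lemma trackable_exists:
  assumes e: "0 < e"
  shows "\<exists>d. trackable e d"
proof -
  obtain d where d: "d > 0" "\<And>x x' r y \<rho>. x \<in> X \<Longrightarrow> x' \<in> X \<Longrightarrow> step x r y \<Longrightarrow> dist x x' < \<rho> \<Longrightarrow> \<rho> \<le> d \<Longrightarrow>
      \<exists>r' y'. step x' r' y' \<and> dist y y' < \<rho> \<and> \<bar>r - r'\<bar> \<le> e"
    using step_track[OF e] by metis
  have "\<exists>rs' y'. play x' rs' y' \<and> dist y y' < \<rho> \<and> length rs' = length rs \<and>
        (\<forall>n. sum_list (take n rs') \<le> sum_list (take n rs) + e * min n (length rs))"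
    if "\<rho> \<le> d" "x \<in> X" "x' \<in> X" "dist x x' < \<rho>" "play x rs y" for \<rho> x x' rs y
    using that
  proof (induction rs arbitrary: x x')
    case Nil
    then show ?case by (intro exI[of _ "[]"] exI[of _ x']) auto
  next
    case (Cons r rs)
    then obtain z where z: "step x r z" "play z rs y" by auto
    obtain r' z' where z': "step x' r' z'" "dist z z' < \<rho>" "\<bar>r - r'\<bar> \<le> e"
      using d(2)[OF Cons.prems(2,3) z(1) Cons.prems(4,1)] by auto
    have "z \<in> X" "z' \<in> X" using step_in z z' Cons.prems by blast+
    then obtain rs' y' where rs': "play z' rs' y'" "dist y y' < \<rho>" "length rs' = length rs"
        "\<And>n. sum_list (take n rs') \<le> sum_list (take n rs) + e * min n (length rs)"
      using Cons.IH[of z z'] Cons.prems z z' by auto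
    have "sum_list (take n (r' # rs')) \<le> sum_list (take n (r # rs)) + e * min n (length (r # rs))" for n
    proof (cases n)
      case (Suc m)
      have "e * min (real (Suc m)) (real (Suc (length rs))) = e * min (real m) (real (length rs)) + e"
        by (simp add: min_def algebra_simps)
      then show ?thesis using rs'(4)[of m] z'(3) Suc by simp
    qed simp
    then show ?case using rs' z' by (intro exI[of _ "r' # rs'"] exI[of _ y']) auto
  qed
  then show ?thesis unfolding trackable_def using d(1) by (intro exI[of _ d]) auto
qed

lemma trackableD:
  assumes "trackable e d" "\<rho> \<le> d" "x \<in> X" "x' \<in> X" "dist x x' < \<rho>" "play x rs y"
  obtains rs' y' where "play x' rs' y'" "dist y y' < \<rho>" "length rs' = length rs"
    "\<And>n. sum_list (take n rs') \<le> sum_list (take n rs) + e * min n (length rs)"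
  using assms unfolding trackable_def by metis

definition below :: "real \<Rightarrow> real list \<Rightarrow> bool" where
  "below c rs \<longleftrightarrow> (\<forall>n\<le>length rs. sum_list (take n rs) \<le> c * n)"

text \<open>Every state at which a transit starts must have this property, since it is what makes the next cheap
block reachable. It allows a different intermediate state \<open>z\<close> for every length \<open>K\<close>.\<close>

definition good :: "real \<Rightarrow> 's \<Rightarrow> bool" where
  "good c x \<longleftrightarrow> (\<forall>K. \<exists>ss z rs y. play x ss z \<and> play z rs y \<and> K \<le> length rs \<and> sum_list rs \<le> c * length rs)"

text \<open>A sequence with average at most \<open>c\<close> has a long suffix all of whose partial averages are at most
\<open>c + \<epsilon>\<close>: start where the excess of the partial sum over the line of slope \<open>c + \<epsilon>\<close> is maximal. The maximal
excess is nonnegative, and then the bound on the total sum prevents it from being attained too close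
to the end.\<close>

lemma below_suffix:
  fixes rs :: "real list" and c \<epsilon> :: real and B :: real and N :: nat
  assumes bound: "\<And>k. k \<le> length rs \<Longrightarrow> \<bar>sum_list (drop k rs)\<bar> \<le> B * (length rs - k)" and B: "0 \<le> B"
    and sum: "sum_list rs \<le> c * length rs" and \<epsilon>: "0 < \<epsilon>"
    and long: "(\<bar>c\<bar> + \<epsilon> + B) * N < \<epsilon> * length rs"
  obtains s where "s + N \<le> length rs" "below (c + \<epsilon>) (drop s rs)"
proof -
  define \<phi> where "\<phi> k = sum_list (take k rs) - (c + \<epsilon>) * k" for k
  obtain s where s: "s \<in> {..length rs}" "\<And>k. k \<in> {..length rs} \<Longrightarrow> \<phi> k \<le> \<phi> s"
  proof -
    have "Max (\<phi> ` {..length rs}) \<in> \<phi> ` {..length rs}" by (intro Max_in) auto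
    then obtain s where "s \<in> {..length rs}" "Max (\<phi> ` {..length rs}) = \<phi> s" by blast
    moreover have "\<phi> k \<le> Max (\<phi> ` {..length rs})" if "k \<in> {..length rs}" for k using that by (intro Max_ge) auto
    ultimately show thesis using that by metis
  qed
  have split: "sum_list (take (s + j) rs) = sum_list (take s rs) + sum_list (take j (drop s rs))" for j
    by (simp add: take_add)
  have "below (c + \<epsilon>) (drop s rs)"
    unfolding below_def
  proof (intro allI impI)
    fix j assume "j \<le> length (drop s rs)"
    then have "\<phi> (s + j) \<le> \<phi> s" using s by auto
    then show "sum_list (take j (drop s rs)) \<le> (c + \<epsilon>) * j"
      unfolding \<phi>_def split of_nat_add by (simp add: distrib_left)
  qed
  moreover have "s + N \<le> length rs"
  proof (rule ccontr)
    assume "\<not> s + N \<le> length rs"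
    define q where "q = real (length rs) - real s"
    have q: "0 \<le> q" "q \<le> N" using s(1) \<open>\<not> s + N \<le> length rs\<close> by (auto simp: q_def)
    have "0 \<le> \<phi> s" using s(2)[of 0] by (simp add: \<phi>_def)
    then have "(c + \<epsilon>) * s \<le> sum_list (take s rs)" by (simp add: \<phi>_def)
    moreover have "sum_list rs = sum_list (take s rs) + sum_list (drop s rs)"
      by (metis append_take_drop_id sum_list_append)
    moreover have "- B * q \<le> sum_list (drop s rs)" using bound[of s] s(1) by (simp add: q_def abs_le_iff of_nat_diff)
    ultimately have "(c + \<epsilon>) * s - B * q \<le> c * length rs" using sum by linarith
    then have "\<epsilon> * length rs \<le> (c + \<epsilon> + B) * q" by (simp add: q_def algebra_simps)
    also have "\<dots> \<le> (\<bar>c\<bar> + \<epsilon> + B) * q" using q by (intro mult_right_mono) auto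
    also have "\<dots> \<le> (\<bar>c\<bar> + \<epsilon> + B) * N" using q \<epsilon> B by (intro mult_left_mono) auto
    finally show False using long by simp
  qed
  ultimately show thesis using that by blast
qed

lemma below_mono: "below c rs \<Longrightarrow> c \<le> c' \<Longrightarrow> below c' rs"
  unfolding below_def by (meson mult_right_mono of_nat_0_le_iff order_trans)

lemma below_take: "below c rs \<Longrightarrow> below c (take N rs)"
  unfolding below_def by (auto simp: min_def)

lemma good_track:
  assumes d: "trackable e d" and "x \<in> X" "x' \<in> X" "dist x x' < d" and g: "good c x"
  shows "good (c + e) x'"
  unfolding good_def
proof
  fix K
  obtain ss z rs y where *: "play x ss z" "play z rs y" "K \<le> length rs" "sum_list rs \<le> c * length rs"
    using g unfolding good_def by metis
  obtain ss' z' where 1: "play x' ss' z'" "dist z z' < d"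
    using trackableD[OF d order_refl assms(2-4) *(1)] by metis
  have z: "z \<in> X" "z' \<in> X" using play_in assms(2,3) *(1) 1(1) by blast+
  obtain rs' y' where 2: "play z' rs' y'" "length rs' = length rs"
    "\<And>n. sum_list (take n rs') \<le> sum_list (take n rs) + e * min n (length rs)"
    using trackableD[OF d order_refl z 1(2) *(2)] by metis
  have "sum_list rs' \<le> (c + e) * length rs'" using 2(3)[of "length rs"] 2(2) *(4) by (simp add: algebra_simps)
  then show "\<exists>ss z rs y. play x' ss z \<and> play z rs y \<and> K \<le> length rs \<and> sum_list rs \<le> (c + e) * length rs"
    using 1(1) 2(1,2) *(3) by metis
qed

text \<open>A finite net reduces the claim to finitely many pairs: for each pair \<open>(a, b)\<close> of net points such that a
state near \<open>b\<close> can be reached from \<open>a\<close>, fix one play that does so. Any transit is imitated from the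
nearest net point, exchanged for the fixed play, and imitated back.\<close>

lemma bounded_transit:
  assumes d: "trackable e d" and \<rho>: "0 < \<rho>"
  shows "\<exists>l. \<forall>x\<in>X. \<forall>ss z. play x ss z \<longrightarrow> (\<exists>ss' z'. play x ss' z' \<and> length ss' \<le> l \<and> dist z z' < \<rho>)"
proof -
  define \<sigma> where "\<sigma> = min d (\<rho> / 4)"
  have \<sigma>: "0 < \<sigma>" "\<sigma> \<le> d" "4 * \<sigma> \<le> \<rho>" using d \<rho> by (auto simp: \<sigma>_def trackable_def)
  obtain k where k: "finite k" "k \<subseteq> X" "X \<subseteq> (\<Union>a\<in>k. ball a \<sigma>)"
    by (rule compactE_image[OF X_compact, of X "\<lambda>a. ball a \<sigma>"]) (use \<sigma>(1) in auto)
  define P where "P a b l \<longleftrightarrow> (\<exists>ss z. play a ss z \<and> dist z b < \<sigma> \<and> length ss \<le> l)" for a b l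
  \<comment> \<open>if no state near \<open>b\<close> can be reached from \<open>a\<close>, this is an arbitrary number, which only makes the bound larger\<close>
  define l where "l a b = (SOME l. P a b l)" for a b
  have l: "P a b (l a b)" if "P a b l'" for a b l' unfolding l_def using that by (rule someI)
  define m where "m = (\<Sum>(a, b)\<in>k \<times> k. l a b)"
  have lm: "l a b \<le> m" if "a \<in> k" "b \<in> k" for a b
  proof -
    have "l a b = (\<Sum>(a, b)\<in>{(a, b)}. l a b)" by simp
    also have "\<dots> \<le> m" unfolding m_def using that k(1) by (intro sum_mono2) auto
    finally show ?thesis .
  qed
  have "\<exists>ss' z'. play x ss' z' \<and> length ss' \<le> m \<and> dist z z' < \<rho>" if x: "x \<in> X" and p: "play x ss z" for x ss z
  proof -
    obtain a where a: "a \<in> k" "dist a x < \<sigma>" using x k by auto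
    then have aX: "a \<in> X" using k by auto
    obtain ss1 z1 where 1: "play a ss1 z1" "dist z z1 < \<sigma>"
      using trackableD[OF d \<sigma>(2) x aX _ p] a by (metis dist_commute)
    have "z1 \<in> X" using play_in[OF aX 1(1)] .
    then obtain b where b: "b \<in> k" "dist b z1 < \<sigma>" using k by auto
    have "P a b (length ss1)" unfolding P_def using 1 b by (metis dist_commute order_refl)
    then obtain ss2 z2 where 2: "play a ss2 z2" "dist z2 b < \<sigma>" "length ss2 \<le> l a b"
      using l unfolding P_def by metis
    obtain ss3 z3 where 3: "play x ss3 z3" "dist z2 z3 < \<sigma>" "length ss3 = length ss2"
      using trackableD[OF d \<sigma>(2) aX x a(2) 2(1)] by metis
    have "dist z z3 \<le> dist z z1 + dist z1 b + dist b z2 + dist z2 z3"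
      using dist_triangle[of z z3 z1] dist_triangle[of z1 z3 b] dist_triangle[of b z3 z2] by linarith
    also have "\<dots> < 4 * \<sigma>" using 1 b 2 3 by (simp add: dist_commute)
    finally have "dist z z3 < \<rho>" using \<sigma> by simp
    then show ?thesis using 3 2 lm[OF a(1) b(1)] by (metis order_trans)
  qed
  then show ?thesis by blast
qed

text \<open>For each \<open>m\<close>, a long cheap play contains a block of \<open>N\<close> moves with small partial averages, followed by
a cheap tail of length at least \<open>m\<close>. The end \<open>w m\<close> of the block depends on \<open>m\<close>, whereas goodness
asks for one state with cheap continuations of every length. By compactness some \<open>w (r I)\<close> is
close to \<open>w m\<close> for infinitely many \<open>m\<close>, and it can imitate all their tails.\<close>

lemma good_block_reachable:
  assumes x: "x \<in> X" and g: "good c x" and \<epsilon>: "0 < \<epsilon>"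
  obtains ss z bs w where "play x ss z" "play z bs w" "length bs = N" "below (c + \<epsilon>) bs" "good (c + \<epsilon>) w"
proof -
  define e where "e = \<epsilon> / 3"
  have e: "0 < e" using \<epsilon> by (simp add: e_def)
  have M: "0 \<le> \<bar>M\<bar>" by simp
  define ends where "ends w \<longleftrightarrow> (\<exists>ss z bs. play x ss z \<and> play z bs w \<and> length bs = N \<and> below (c + e) bs)" for w
  define tail where "tail m w \<longleftrightarrow> (\<exists>ts v. play w ts v \<and> m \<le> length ts \<and> sum_list ts \<le> (c + 2 * e) * length ts)"
    for m w
  have tails: "\<exists>w. ends w \<and> tail m w" for m
  proof -
    \<comment> \<open>long enough for the unknown cost of the block, at most \<open>M * N\<close> in absolute value, to be negligible in the average of the tail\<close>
    define m' where "m' = max m (nat \<lceil>(\<bar>M\<bar> + \<bar>c\<bar> + e) * N / e\<rceil>)"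
    have m': "m \<le> m'" "(\<bar>M\<bar> + \<bar>c\<bar> + e) * N \<le> e * m'"
    proof -
      have "(\<bar>M\<bar> + \<bar>c\<bar> + e) * N / e \<le> real (nat \<lceil>(\<bar>M\<bar> + \<bar>c\<bar> + e) * N / e\<rceil>)" by (rule real_nat_ceiling_ge)
      also have "\<dots> \<le> real m'" by (simp add: m'_def)
      finally show "(\<bar>M\<bar> + \<bar>c\<bar> + e) * N \<le> e * m'" using e by (simp add: field_simps)
    qed (simp add: m'_def)
    define Q where "Q = nat \<lceil>(\<bar>c\<bar> + e + \<bar>M\<bar>) * (N + m') / e\<rceil> + 1"
    obtain ss z rs y where *: "play x ss z" "play z rs y" "Q \<le> length rs" "sum_list rs \<le> c * length rs"
      using g unfolding good_def by metis
    have zX: "z \<in> X" using play_in[OF x *(1)] .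
    have long: "(\<bar>c\<bar> + e + \<bar>M\<bar>) * (N + m') < e * length rs"
    proof -
      have "(\<bar>c\<bar> + e + \<bar>M\<bar>) * (N + m') / e \<le> real (nat \<lceil>(\<bar>c\<bar> + e + \<bar>M\<bar>) * (N + m') / e\<rceil>)"
        by (rule real_nat_ceiling_ge)
      also have "\<dots> < real (length rs)" using *(3) by (simp add: Q_def)
      finally show ?thesis using e by (simp add: field_simps)
    qed
    have bound: "\<bar>sum_list (drop k rs)\<bar> \<le> \<bar>M\<bar> * (length rs - k)" if k: "k \<le> length rs" for k
    proof -
      have "play z (take k rs @ drop k rs) y" using *(2) by simp
      then obtain q where "play z (take k rs) q" "play q (drop k rs) y" unfolding play_append by blast
      then have "\<bar>sum_list (drop k rs)\<bar> \<le> M * length (drop k rs)" using play_cost play_in zX by blast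
      also have "\<dots> \<le> \<bar>M\<bar> * length (drop k rs)" by (intro mult_right_mono) auto
      finally show ?thesis by simp
    qed
    obtain s where s: "s + (N + m') \<le> length rs" "below (c + e) (drop s rs)"
      using below_suffix[OF bound M *(4) e, of "N + m'"] long by auto
    define bs where "bs = take N (drop s rs)"
    define ts where "ts = drop N (drop s rs)"
    have rs: "rs = take s rs @ bs @ ts" by (simp add: bs_def ts_def del: drop_drop)
    then have "play z (take s rs @ bs @ ts) y" using *(2) by simp
    then obtain p w where pw: "play z (take s rs) p" "play p bs w" "play w ts y" unfolding play_append by blast
    have lens: "length bs = N" "m' \<le> length ts" using s(1) by (auto simp: bs_def ts_def)
    have "\<bar>sum_list bs\<bar> \<le> M * N"
      using play_cost[OF play_in[OF zX pw(1)] pw(2)] lens by simp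
    also have "\<dots> \<le> \<bar>M\<bar> * N" by (intro mult_right_mono) auto
    finally have bsum: "- (\<bar>M\<bar> * N) \<le> sum_list bs" by linarith
    have ds: "drop s rs = bs @ ts" by (simp add: bs_def ts_def del: drop_drop)
    have "sum_list (bs @ ts) \<le> (c + e) * length (bs @ ts)"
      using s(2)[unfolded ds below_def, rule_format, of "length (bs @ ts)"] by simp
    then have "sum_list ts \<le> (c + e) * length ts + (c + e) * N + \<bar>M\<bar> * N"
      using bsum lens by (simp add: algebra_simps)
    also have "\<dots> \<le> (c + e) * length ts + (\<bar>M\<bar> + \<bar>c\<bar> + e) * N"
      by (simp add: algebra_simps mult_right_mono)
    also have "\<dots> \<le> (c + e) * length ts + e * length ts"
    proof -
      have "e * m' \<le> e * length ts" using lens(2) e by (intro mult_left_mono) auto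
      then show ?thesis using m'(2) by linarith
    qed
    finally have tsum: "sum_list ts \<le> (c + 2 * e) * length ts" by (simp add: algebra_simps)
    have "play x (ss @ take s rs) p" using *(1) pw(1) unfolding play_append by blast
    moreover have "below (c + e) bs" unfolding bs_def by (rule below_take[OF s(2)])
    ultimately have "ends w" unfolding ends_def using pw(2) lens(1)
      by (intro exI[of _ "ss @ take s rs"] exI[of _ p] exI[of _ bs] conjI)
    moreover have "tail m w" unfolding tail_def using pw(3) tsum lens(2) m'(1)
      by (intro exI[of _ ts] exI[of _ y] conjI) simp_all
    ultimately show ?thesis by blast
  qed
  obtain w where w: "\<And>m. ends (w m)" "\<And>m. tail m (w m)"
    using choice[of "\<lambda>m w. ends w \<and> tail m w"] tails by blast
  have wX: "w m \<in> X" for m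
    using w(1)[of m] play_in[OF x] play_in unfolding ends_def by blast
  obtain d where d: "trackable e d" using trackable_exists[OF e] by blast
  obtain l r where lr: "strict_mono r" "(w \<circ> r) \<longlonglongrightarrow> l"
    using X_compact[unfolded compact_def, rule_format, of w] wX by auto
  have "Cauchy (w \<circ> r)" using lr(2) by (rule LIMSEQ_imp_Cauchy)
  then obtain I where I: "\<And>i j. I \<le> i \<Longrightarrow> I \<le> j \<Longrightarrow> dist (w (r i)) (w (r j)) < d"
    using d unfolding Cauchy_def trackable_def o_def by metis
  have "good (c + 3 * e) (w (r I))"
    unfolding good_def
  proof
    fix K
    define i where "i = max I K"
    have near: "dist (w (r i)) (w (r I)) < d" by (rule I) (simp_all add: i_def)
    have Ki: "K \<le> r i" using seq_suble[OF lr(1), of i] by (simp add: i_def)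
    obtain ts v where T: "play (w (r i)) ts v" "r i \<le> length ts" "sum_list ts \<le> (c + 2 * e) * length ts"
      using w(2)[of "r i"] unfolding tail_def by blast
    obtain rs' y' where 2: "play (w (r I)) rs' y'" "length rs' = length ts"
      "\<And>n. sum_list (take n rs') \<le> sum_list (take n ts) + e * min n (length ts)"
      using trackableD[OF d order_refl wX wX near T(1)] by metis
    have "sum_list rs' \<le> (c + 3 * e) * length rs'"
      using 2(3)[of "length rs'"] 2(2) T(3) by (simp add: algebra_simps)
    moreover have "K \<le> length rs'" using 2(2) T(2) Ki by simp
    moreover have "play (w (r I)) [] (w (r I))" by simp
    ultimately show "\<exists>ss z rs y. play (w (r I)) ss z \<and> play z rs y \<and> K \<le> length rs \<and>
        sum_list rs \<le> (c + 3 * e) * length rs" using 2(1) by blast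
  qed
  then have "good (c + \<epsilon>) (w (r I))" by (simp add: e_def)
  moreover obtain ss z bs where "play x ss z" "play z bs (w (r I))" "length bs = N" "below (c + e) bs"
    using w(1)[of "r I"] unfolding ends_def by blast
  moreover have "below (c + \<epsilon>) bs"
    by (rule below_mono[OF \<open>below (c + e) bs\<close>]) (use \<epsilon> in \<open>simp add: e_def\<close>)
  ultimately show thesis by (intro that)
qed

text \<open>The bound \<open>l\<close> depends neither on the state nor on the length \<open>N\<close> of the block. This allows the length of a
block to be chosen in view of the transit that comes after it.\<close>

lemma good_block_after_bounded_transit:
  assumes \<epsilon>: "0 < \<epsilon>"
  shows "\<exists>l. \<forall>x\<in>X. \<forall>c N. good c x \<longrightarrow> (\<exists>ss z bs w. play x ss z \<and> length ss \<le> l \<and>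
     play z bs w \<and> length bs = N \<and> below (c + \<epsilon>) bs \<and> good (c + \<epsilon>) w)"
proof -
  obtain d where d: "trackable (\<epsilon> / 2) d" using trackable_exists[of "\<epsilon> / 2"] \<epsilon> by auto
  then have "0 < d" by (simp add: trackable_def)
  then obtain l where l: "\<And>x ss z. x \<in> X \<Longrightarrow> play x ss z \<Longrightarrow>
      \<exists>ss' z'. play x ss' z' \<and> length ss' \<le> l \<and> dist z z' < d"
    using bounded_transit[OF d] by metis
  have "\<exists>ss z bs w. play x ss z \<and> length ss \<le> l \<and>
     play z bs w \<and> length bs = N \<and> below (c + \<epsilon>) bs \<and> good (c + \<epsilon>) w" if x: "x \<in> X" and g: "good c x" for x c N
  proof -
    obtain ss z bs w where 1: "play x ss z" "play z bs w" "length bs = N" "below (c + \<epsilon> / 2) bs" "good (c + \<epsilon> / 2) w"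
      using good_block_reachable[OF x g, of "\<epsilon> / 2"] \<epsilon> by (metis half_gt_zero)
    obtain ss' z' where 2: "play x ss' z'" "length ss' \<le> l" "dist z z' < d"
      using l[OF x 1(1)] by metis
    have X: "z \<in> X" "z' \<in> X" using play_in[OF x] 1(1) 2(1) by auto
    obtain bs' w' where 3: "play z' bs' w'" "dist w w' < d" "length bs' = length bs"
      "\<And>n. sum_list (take n bs') \<le> sum_list (take n bs) + \<epsilon> / 2 * min n (length bs)"
      using trackableD[OF d order_refl X 2(3) 1(2)] by metis
    have "good (c + \<epsilon> / 2 + \<epsilon> / 2) w'"
      by (rule good_track[OF d play_in[OF X(1) 1(2)] play_in[OF X(2) 3(1)] 3(2) 1(5)])
    moreover have "below (c + \<epsilon>) bs'"
      unfolding below_def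
    proof (intro allI impI)
      fix n assume n: "n \<le> length bs'"
      have "sum_list (take n bs') \<le> sum_list (take n bs) + \<epsilon> / 2 * n" using 3(4)[of n] n 3(3) by simp
      also have "sum_list (take n bs) \<le> (c + \<epsilon> / 2) * n" using 1(4) n 3(3) by (simp add: below_def)
      finally show "sum_list (take n bs') \<le> (c + \<epsilon>) * n" by (simp add: algebra_simps)
    qed
    ultimately show ?thesis using 2 3 1(3) by (metis add.assoc field_sum_of_halves)
  qed
  then show ?thesis by blast
qed

text \<open>Stage \<open>k\<close> starts at a state that is good for \<open>ck k\<close> and consists of a transit of length at most \<open>l k\<close>
and a block. Relative to the line of slope \<open>\<kappa>\<close>, a transit loses at most \<open>b * l k\<close>, while a block
gains \<open>\<epsilon> / 2\<close> per move, because its partial averages are at most \<open>\<kappa> - \<epsilon> / 2\<close>. The block is made long enough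
to gain \<open>b * l (Suc k)\<close>, the possible loss of the next transit. Thus the excess \<open>D\<close> over the line never
exceeds \<open>B\<close>.

The stages have varying lengths, so the play is built move by move. The invariant \<open>Inv x D\<close> says that at
state \<open>x\<close> with excess \<open>D\<close> the remainder of some stage is still planned; when it is used up, the
next stage is planned.\<close>

theorem good_infinite_play:
  assumes x: "x \<in> X" and g: "good c x" and \<epsilon>: "0 < \<epsilon>"
  obtains xs rs B where "xs 0 = x" "\<And>n. xs n \<in> X" "\<And>n. step (xs n) (rs n) (xs (Suc n))"
    "\<And>n. (\<Sum>i<n. rs i) \<le> (c + \<epsilon>) * n + B"
proof -
  define \<kappa> where "\<kappa> = c + \<epsilon>"
  define b where "b = \<bar>M\<bar> + \<bar>\<kappa>\<bar>"
  define ck where "ck k = c + \<epsilon> / 2 - \<epsilon> / 2 ^ (k + 1)" for k :: nat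
  define ek where "ek k = \<epsilon> / 2 ^ (k + 2)" for k :: nat
  have ek: "0 < ek k" "ck k + ek k = ck (Suc k)" for k
    using \<epsilon> by (auto simp: ek_def ck_def field_simps)
  have ck0: "ck 0 = c" and ckle: "ck k \<le> \<kappa> - \<epsilon> / 2" for k
    using \<epsilon> by (auto simp: ck_def \<kappa>_def)
  have b: "0 \<le> b" by (simp add: b_def)
  obtain l where l: "\<And>k. \<forall>x\<in>X. \<forall>c N. good c x \<longrightarrow> (\<exists>ss z bs w. play x ss z \<and> length ss \<le> l k \<and>
     play z bs w \<and> length bs = N \<and> below (c + ek k) bs \<and> good (c + ek k) w)"
    using choice[of "\<lambda>k l. \<forall>x\<in>X. \<forall>c N. good c x \<longrightarrow> (\<exists>ss z bs w. play x ss z \<and> length ss \<le> l \<and>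
     play z bs w \<and> length bs = N \<and> below (c + ek k) bs \<and> good (c + ek k) w)"]
      good_block_after_bounded_transit[OF ek(1)] by blast
  define B where "B = b * l 0"
  define sum\<kappa> where "sum\<kappa> rs = sum_list rs - \<kappa> * length rs" for rs :: "real list"
  define plan where "plan k D x rs y \<longleftrightarrow> play x rs y \<and> (\<forall>n\<le>length rs. D + sum\<kappa> (take n rs) \<le> B) \<and>
      D + sum\<kappa> rs \<le> B - b * l k \<and> good (ck k) y" for k D x rs y
  define Inv where "Inv x D \<longleftrightarrow> x \<in> X \<and> (\<exists>k rs y. rs \<noteq> [] \<and> plan k D x rs y)" for x D
  have new_plan: "Inv x D" if x: "x \<in> X" and g: "good (ck k) x" and D: "D \<le> B - b * l k" for x D k
  proof -
    define N where "N = nat \<lceil>b * l (Suc k) / (\<epsilon> / 2)\<rceil> + 1"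
    have N: "b * l (Suc k) \<le> \<epsilon> / 2 * N"
    proof -
      have "b * l (Suc k) / (\<epsilon> / 2) \<le> real N"
        unfolding N_def using real_nat_ceiling_ge[of "b * l (Suc k) / (\<epsilon> / 2)"] by linarith
      then show ?thesis using \<epsilon> by (simp add: field_simps)
    qed
    obtain ss z bs w where p: "play x ss z" "length ss \<le> l k" "play z bs w" "length bs = N"
        "below (ck k + ek k) bs" "good (ck k + ek k) w"
      using l[of k] x g by blast
    have ss: "D + sum\<kappa> (take n ss) \<le> B" for n
    proof -
      have "play x (take n ss @ drop n ss) z" using p(1) by simp
      then obtain q where "play x (take n ss) q" unfolding play_append by blast
      then have "\<bar>sum_list (take n ss)\<bar> \<le> M * length (take n ss)" by (rule play_cost[OF x])
      also have "\<dots> \<le> \<bar>M\<bar> * length (take n ss)" by (intro mult_right_mono) auto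
      finally have "sum_list (take n ss) \<le> \<bar>M\<bar> * length (take n ss)" by linarith
      moreover have "- \<kappa> * length (take n ss) \<le> \<bar>\<kappa>\<bar> * length (take n ss)" by (intro mult_right_mono) auto
      ultimately have "sum\<kappa> (take n ss) \<le> b * length (take n ss)"
        unfolding sum\<kappa>_def b_def distrib_right by linarith
      also have "\<dots> \<le> b * l k" using p(2) b by (intro mult_left_mono) auto
      finally show ?thesis using D by linarith
    qed
    have bs: "sum\<kappa> (take n bs) \<le> - (\<epsilon> / 2) * n" if "n \<le> N" for n
    proof -
      have "sum_list (take n bs) \<le> ck (Suc k) * n" using p(4,5) that by (simp add: below_def ek)
      also have "\<dots> \<le> (\<kappa> - \<epsilon> / 2) * n" using ckle by (intro mult_right_mono) auto
      finally show ?thesis using that p(4) by (simp add: sum\<kappa>_def algebra_simps)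
    qed
    have app: "sum\<kappa> (as @ cs) = sum\<kappa> as + sum\<kappa> cs" for as cs by (simp add: sum\<kappa>_def algebra_simps)
    have "plan (Suc k) D x (ss @ bs) w"
      unfolding plan_def
    proof (intro conjI allI impI)
      show "play x (ss @ bs) w" unfolding play_append using p(1,3) by blast
      fix n assume n: "n \<le> length (ss @ bs)"
      show "D + sum\<kappa> (take n (ss @ bs)) \<le> B"
      proof (cases "n \<le> length ss")
        case True
        then show ?thesis using ss[of n] by simp
      next
        case False
        have "sum\<kappa> (take (n - length ss) bs) \<le> - (\<epsilon> / 2) * (n - length ss)"
          using n p(4) by (intro bs) auto
        also have "\<dots> \<le> 0" using \<epsilon> by simp
        finally show ?thesis using ss[of "length ss"] False by (simp add: app)
      qed
    next
      have "sum\<kappa> bs \<le> - (\<epsilon> / 2) * N" using bs[of N] p(4) by simp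
      then show "D + sum\<kappa> (ss @ bs) \<le> B - b * l (Suc k)"
        using ss[of "length ss"] N by (simp add: app)
      show "good (ck (Suc k)) w" using p(6) by (simp add: ek)
    qed
    moreover have "ss @ bs \<noteq> []" using p(4) by (auto simp: N_def)
    ultimately show ?thesis unfolding Inv_def using x by blast
  qed
  have next_step: "\<exists>r y. step x r y \<and> Inv y (D + r - \<kappa>)" if inv: "Inv x D" for x D
  proof -
    obtain k rs y where p: "rs \<noteq> []" "plan k D x rs y" and x: "x \<in> X" using inv unfolding Inv_def by blast
    then obtain r rs' where rs: "rs = r # rs'" by (cases rs) auto
    then obtain z where z: "step x r z" "play z rs' y" using p(2) by (auto simp: plan_def)
    have zX: "z \<in> X" using step_in[OF x z(1)] .
    have shift: "D + sum\<kappa> (r # as) = (D + r - \<kappa>) + sum\<kappa> as" for as by (simp add: sum\<kappa>_def algebra_simps)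
    have D': "D + r - \<kappa> + sum\<kappa> rs' \<le> B - b * l k" "good (ck k) y"
      using p(2) by (simp_all add: plan_def rs shift)
    have pre: "(D + r - \<kappa>) + sum\<kappa> (take n rs') \<le> B" if "n \<le> length rs'" for n
    proof -
      have "D + sum\<kappa> (take (Suc n) rs) \<le> B" using p(2) that unfolding plan_def rs by auto
      then show ?thesis by (simp add: rs shift)
    qed
    have "Inv z (D + r - \<kappa>)"
    proof (cases "rs' = []")
      case True
      then show ?thesis using new_plan[OF zX, of k "D + r - \<kappa>"] D' z(2) by (simp add: sum\<kappa>_def)
    next
      case False
      have "plan k (D + r - \<kappa>) z rs' y" unfolding plan_def using z(2) pre D' by blast
      then show ?thesis unfolding Inv_def using zX False by blast
    qed
    then show ?thesis using z(1) by blast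
  qed
  have Inv_le: "D \<le> B" if inv: "Inv x D" for x D
  proof -
    obtain k rs y where "plan k D x rs y" using inv unfolding Inv_def by blast
    then have "D + sum\<kappa> (take 0 rs) \<le> B" unfolding plan_def by blast
    then show ?thesis by (simp add: sum\<kappa>_def)
  qed
  \<comment> \<open>the cost of a move is recovered from the change of the excess\<close>
  define S where "S p q \<longleftrightarrow> step (fst p) (snd q - snd p + \<kappa>) (fst q)" for p q :: "'s \<times> real"
  have "Inv x 0" by (rule new_plan[OF x, of 0]) (use g ck0 in \<open>auto simp: B_def\<close>)
  then have "\<exists>p. \<forall>n. (Inv (fst (p n)) (snd (p n)) \<and> (n = 0 \<longrightarrow> p n = (x, 0))) \<and> S (p n) (p (Suc n))"
  proof (intro dependent_nat_choice)
    fix p and n :: nat assume "Inv (fst p) (snd p) \<and> (n = 0 \<longrightarrow> p = (x, 0))"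
    then obtain r y where "step (fst p) r y" "Inv y (snd p + r - \<kappa>)" using next_step by blast
    then show "\<exists>q. (Inv (fst q) (snd q) \<and> (Suc n = 0 \<longrightarrow> q = (x, 0))) \<and> S p q"
      by (intro exI[of _ "(y, snd p + r - \<kappa>)"]) (simp add: S_def)
  qed auto
  then obtain p where p: "\<And>n. Inv (fst (p n)) (snd (p n))" "p 0 = (x, 0)" "\<And>n. S (p n) (p (Suc n))" by auto
  show thesis
  proof (rule that[of "\<lambda>n. fst (p n)" "\<lambda>n. snd (p (Suc n)) - snd (p n) + \<kappa>" B])
    show "fst (p n) \<in> X" for n using p(1)[of n] by (simp add: Inv_def)
    show "step (fst (p n)) (snd (p (Suc n)) - snd (p n) + \<kappa>) (fst (p (Suc n)))" for n
      using p(3)[of n] by (simp add: S_def)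
    fix n
    have "(\<Sum>i<n. snd (p (Suc i)) - snd (p i) + \<kappa>) = snd (p n) + \<kappa> * n"
      by (induction n) (simp_all add: p(2) algebra_simps)
    then show "(\<Sum>i<n. snd (p (Suc i)) - snd (p i) + \<kappa>) \<le> (c + \<epsilon>) * n + B"
      using Inv_le[OF p(1)[of n]] by (simp add: \<kappa>_def)
  qed (simp add: p(2))
qed

end

section \<open>Uniform evaluations\<close>

definition uniform_evaluation :: "real \<Rightarrow> real measure" where
  "uniform_evaluation T = restrict_space (density lborel (\<lambda>s. ennreal (indicator {0..T} s / T))) {0..}"

lemma space_uniform_evaluation: "space (uniform_evaluation T) = {0..}"
  by (simp add: uniform_evaluation_def space_restrict_space)

lemma sets_uniform_evaluation [measurable_cong]: "sets (uniform_evaluation T) = sets (restrict_space borel {0..})"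
  unfolding uniform_evaluation_def by (intro sets_restrict_space_cong) simp

lemma emeasure_uniform_evaluation:
  assumes T: "0 < T" and Q: "Q \<in> sets (restrict_space borel {0..})"
  shows "emeasure (uniform_evaluation T) Q = ennreal (measure lborel (Q \<inter> {0..T}) / T)"
proof -
  have Qb: "Q \<in> sets borel" "Q \<subseteq> {0..}" using Q by (simp_all add: sets_restrict_space_iff)
  have "emeasure (uniform_evaluation T) Q = emeasure (density lborel (\<lambda>s. ennreal (indicator {0..T} s / T))) Q"
    unfolding uniform_evaluation_def using Qb by (intro emeasure_restrict_space) auto
  also have "\<dots> = (\<integral>\<^sup>+ s. ennreal (indicator {0..T} s / T) * indicator Q s \<partial>lborel)"
    using Qb by (intro emeasure_density) auto
  also have "\<dots> = (\<integral>\<^sup>+ s. ennreal (1 / T) * indicator (Q \<inter> {0..T}) s \<partial>lborel)"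
    by (intro nn_integral_cong) (auto simp: indicator_def)
  also have "\<dots> = ennreal (1 / T) * emeasure lborel (Q \<inter> {0..T})"
    using Qb by (intro nn_integral_cmult_indicator) auto
  also have "emeasure lborel (Q \<inter> {0..T}) = ennreal (measure lborel (Q \<inter> {0..T}))"
  proof (rule emeasure_eq_ennreal_measure)
    have "emeasure lborel (Q \<inter> {0..T}) \<le> emeasure lborel {0..T}" by (intro emeasure_mono) auto
    also have "\<dots> < \<infinity>" using T by simp
    finally show "emeasure lborel (Q \<inter> {0..T}) \<noteq> \<top>" by simp
  qed
  finally show ?thesis using T by (simp add: ennreal_mult[symmetric])
qed

lemma uniform_evaluation_in: 
  assumes T: "0 < T"
  shows "uniform_evaluation T \<in> evaluations"
proof -
  have "emeasure (uniform_evaluation T) (space (uniform_evaluation T)) = ennreal (measure lborel ({0..} \<inter> {0..T}) / T)"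
    unfolding space_uniform_evaluation by (rule emeasure_uniform_evaluation[OF T]) (simp add: sets_restrict_space_iff)
  also have "{0..} \<inter> {0..T} = {0..T}" by auto
  finally have "prob_space (uniform_evaluation T)" using T by (intro prob_spaceI) simp
  then show ?thesis by (simp add: evaluations_def sets_uniform_evaluation)
qed

lemma integral_uniform_evaluation:
  fixes h :: "real \<Rightarrow> real"
  assumes T: "0 < T" and h: "continuous_on {0..} h"
  shows "(LINT s|uniform_evaluation T. h s) = integral {0..T} h / T"
proof -
  have hm: "(\<lambda>s. indicator {0..} s *\<^sub>R h s) \<in> borel_measurable borel"
    using borel_measurable_continuous_on_restrict[OF h]
    by (subst (asm) borel_measurable_restrict_space_iff) auto
  have int: "set_integrable lborel {0..T} h"
    by (rule borel_integrable_atLeastAtMost') (rule continuous_on_subset[OF h], auto)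
  have "(LINT s|uniform_evaluation T. h s)
      = (LINT s|density lborel (\<lambda>s. ennreal (indicator {0..T} s / T)). indicator {0..} s *\<^sub>R h s)"
    unfolding uniform_evaluation_def by (intro integral_restrict_space) auto
  also have "\<dots> = (LINT s|lborel. (indicator {0..T} s / T) *\<^sub>R (indicator {0..} s *\<^sub>R h s))"
    using hm T by (intro integral_density) auto
  also have "\<dots> = (LINT s|lborel. (1 / T) *\<^sub>R (indicator {0..T} s *\<^sub>R h s))"
    by (intro Bochner_Integration.integral_cong) (auto simp: indicator_def)
  also have "\<dots> = (1 / T) * (LINT s:{0..T}|lborel. h s)"
    by (simp add: set_lebesgue_integral_def)
  also have "(LINT s:{0..T}|lborel. h s) = integral {0..T} h"
    by (rule set_borel_integral_eq_integral(2)[OF int])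
  finally show ?thesis by simp
qed

text \<open>Shifting \<open>Q\<close> by \<open>s\<close> keeps the measure of its part in \<open>[0, T - s]\<close> and moves only a set of length at most
\<open>s\<close> out of \<open>[0, T]\<close>.\<close>

lemma TV_uniform_evaluation_le:
  assumes T: "0 < T" and s: "0 \<le> s"
  shows "TV s (uniform_evaluation T) \<le> s / T"
  unfolding TV_def
proof (rule cSUP_least)
  fix Q :: "real set" assume Q: "Q \<in> sets (restrict_space borel {0..})"
  define Q' where "Q' = (\<lambda>t. t + s) ` Q"
  have Qb: "Q \<in> sets borel" "Q \<subseteq> {0..}" using Q by (simp_all add: sets_restrict_space_iff)
  have fin: "emeasure lborel (B \<inter> {a..b}) \<noteq> \<infinity>" for B and a b :: real
  proof -
    have "emeasure lborel (B \<inter> {a..b}) \<le> emeasure lborel {a..b}" by (intro emeasure_mono) auto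
    also have "\<dots> < \<infinity>" by (cases "a \<le> b") auto
    finally show ?thesis by simp
  qed
  have "Q' = (\<lambda>t. - s + t) -` Q" unfolding Q'_def by (auto intro!: image_eqI[of _ _ "_ - s"])
  moreover have "(\<lambda>t. - s + t) -` Q \<in> sets borel"
    using measurable_sets[of "\<lambda>t. - s + t" borel borel Q] Qb by simp
  ultimately have Q'b: "Q' \<in> sets borel" "Q' \<subseteq> {0..}" using Qb s by (auto simp: Q'_def)
  have meas: "measure (uniform_evaluation T) B = measure lborel (B \<inter> {0..T}) / T"
    if "B \<in> sets borel" "B \<subseteq> {0..}" for B
    using emeasure_uniform_evaluation[OF T, of B] that T
    by (simp add: sets_restrict_space_iff measure_def divide_nonneg_pos)
  have "Q' \<inter> {0..T} = (\<lambda>t. - s + t) -` (Q \<inter> {0..T - s})"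
    unfolding \<open>Q' = (\<lambda>t. - s + t) -` Q\<close> using Qb s by auto
  moreover have "measure (distr lborel borel ((+) (- s))) (Q \<inter> {0..T - s})
      = measure lborel ((\<lambda>t. - s + t) -` (Q \<inter> {0..T - s}))"
    using Qb by (subst measure_distr) (simp_all only: space_lborel Int_UNIV_right, auto)
  ultimately have "measure lborel (Q' \<inter> {0..T}) = measure (distr lborel borel ((+) (- s))) (Q \<inter> {0..T - s})"
    by (simp only:)
  then have shifted: "measure lborel (Q' \<inter> {0..T}) = measure lborel (Q \<inter> {0..T - s})"
    by (simp add: lborel_distr_plus)
  have "measure lborel (Q \<inter> {0..T - s}) \<le> measure lborel (Q \<inter> {0..T})"
    using Qb s fin[of Q 0 T] by (intro measure_mono_fmeasurable) (auto simp: fmeasurable_def top.not_eq_extremum)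
  moreover have "measure lborel (Q \<inter> {0..T}) \<le> measure lborel (Q \<inter> {0..T - s}) + s"
  proof -
    have "measure lborel (Q \<inter> {0..T}) \<le> measure lborel ((Q \<inter> {0..T - s}) \<union> {T - s..T})"
      using Qb fin[of Q 0 "T - s"] s by (intro measure_mono_fmeasurable fmeasurable.Un) (auto simp: fmeasurable_def top.not_eq_extremum)
    also have "\<dots> \<le> measure lborel (Q \<inter> {0..T - s}) + measure lborel {T - s..T}"
      using Qb by (intro measure_Un_le) auto
    finally show ?thesis using s by simp
  qed
  ultimately show "\<bar>measure (uniform_evaluation T) Q - measure (uniform_evaluation T) ((\<lambda>t. t + s) ` Q)\<bar> \<le> s / T"
    using T unfolding Q'_def[symmetric] meas[OF Qb] meas[OF Q'b] shifted
    by (simp add: diff_divide_distrib[symmetric] divide_right_mono)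
qed (use sets.top in auto)

section \<open>Average costs of a nonexpansive control problem\<close>

locale nonexpansive_control = nonexpansive_ode U f L A Y
  for U :: "'u::{metric_space, second_countable_topology} set"
    and f :: "'a::euclidean_space \<Rightarrow> 'u \<Rightarrow> 'a" and L A :: real and Y :: "'a set" +
  fixes g :: "'a \<Rightarrow> real" and M :: real
  assumes g_continuous: "continuous_on Y g" and g_bound: "\<bar>g y\<bar> \<le> M"
begin

definition running :: "(real \<Rightarrow> 'u) \<Rightarrow> 'a \<Rightarrow> real \<Rightarrow> real" where
  "running u x s = g (trajectory f u x s)"

lemma M_nonneg: "0 \<le> M" using g_bound[of undefined] by linarith

lemma running_bound: "\<bar>running u x s\<bar> \<le> M" by (simp add: running_def g_bound)

lemma running_continuous:
  assumes "u \<in> controls U" "x \<in> Y"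
  shows "continuous_on {0..} (running u x)"
proof -
  have "continuous_on {0..} (g \<circ> trajectory f u x)"
    using assms invariant
    by (intro continuous_on_compose trajectory_continuous continuous_on_subset[OF g_continuous]) auto
  then show ?thesis by (simp add: o_def running_def)
qed

lemma running_integrable:
  assumes "u \<in> controls U" "x \<in> Y" "0 \<le> a"
  shows "running u x integrable_on {a..b}"
  by (rule integrable_continuous_interval) (rule continuous_on_subset[OF running_continuous[OF assms(1,2)]], use assms(3) in auto)

lemma running_integral_bound:
  assumes "u \<in> controls U" "x \<in> Y" "0 \<le> a" "a \<le> b"
  shows "\<bar>integral {a..b} (running u x)\<bar> \<le> M * (b - a)"
proof -
  have "norm (integral {a..b} (running u x)) \<le> integral {a..b} (\<lambda>_. M)"
    using running_bound by (intro integral_norm_bound_integral running_integrable assms) auto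
  then show ?thesis using assms by (simp add: mult.commute)
qed

lemma running_integral_combine:
  assumes "u \<in> controls U" "x \<in> Y" "0 \<le> a" "a \<le> b" "b \<le> c"
  shows "integral {a..c} (running u x) = integral {a..b} (running u x) + integral {b..c} (running u x)"
  using Henstock_Kurzweil_Integration.integral_combine[of a b c "running u x"] running_integrable assms by simp

lemma running_shift:
  assumes "u \<in> controls U" "0 \<le> s" "0 \<le> t"
  shows "running u x (s + t) = running (\<lambda>r. u (s + r)) (trajectory f u x s) t"
  using trajectory_shift[OF assms] by (simp add: running_def)

lemma integral_shift_running:
  assumes u: "u \<in> controls U" and x: "x \<in> Y" and s: "0 \<le> s" and t: "0 \<le> t"
  shows "integral {0..t} (\<lambda>r. running u x (s + r)) = integral {s..s + t} (running u x)"
proof -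
  have "(running u x has_integral integral {s..s + t} (running u x)) (cbox s (s + t))"
    using running_integrable[OF u x s] by (simp add: integrable_integral)
  from has_integral_affinity[OF this, of 1 s]
  have "((\<lambda>r. running u x (s + r)) has_integral integral {s..s + t} (running u x)) {0..t}"
    using t by (simp add: add.commute)
  then show ?thesis by (rule integral_unique)
qed

lemma integral_running_shift:
  assumes u: "u \<in> controls U" and x: "x \<in> Y" and s: "0 \<le> s" and t: "0 \<le> t"
  shows "integral {s..s + t} (running u x) = integral {0..t} (running (\<lambda>r. u (s + r)) (trajectory f u x s))"
proof -
  have "integral {0..t} (\<lambda>r. running u x (s + r)) = integral {0..t} (running (\<lambda>r. u (s + r)) (trajectory f u x s))"
    by (rule Henstock_Kurzweil_Integration.integral_cong) (use running_shift[OF u s] in auto)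
  then show ?thesis using integral_shift_running[OF assms] by simp
qed

text \<open>The two averages differ by the contributions of \<open>[0, s]\<close> and \<open>[T, s + T]\<close>, and trivially by at most
\<open>2 * M\<close>. The second bound keeps the error integrable for an arbitrary evaluation of \<open>s\<close>.\<close>

lemma average_shift_le:
  assumes u: "u \<in> controls U" and x: "x \<in> Y" and s: "0 \<le> s" and T: "0 < T"
  shows "integral {s..s + T} (running u x) / T \<le> integral {0..T} (running u x) / T + min (2 * M * s / T) (2 * M)"
proof -
  have c1: "integral {0..T} (running u x) + integral {T..s + T} (running u x) = integral {0..s + T} (running u x)"
    using running_integral_combine[OF u x, of 0 T "s + T"] s T by simp
  have c2: "integral {0..s} (running u x) + integral {s..s + T} (running u x) = integral {0..s + T} (running u x)"
    using running_integral_combine[OF u x, of 0 s "s + T"] s T by simp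
  have b: "\<bar>integral {T..s + T} (running u x)\<bar> \<le> M * s" "\<bar>integral {0..s} (running u x)\<bar> \<le> M * s"
    "\<bar>integral {0..T} (running u x)\<bar> \<le> M * T" "\<bar>integral {s..s + T} (running u x)\<bar> \<le> M * T"
    using running_integral_bound[OF u x, of T "s + T"] running_integral_bound[OF u x, of 0 s]
      running_integral_bound[OF u x, of 0 T] running_integral_bound[OF u x, of s "s + T"] s T by auto
  have "integral {s..s + T} (running u x) \<le> integral {0..T} (running u x) + 2 * M * s"
    "integral {s..s + T} (running u x) \<le> integral {0..T} (running u x) + 2 * M * T"
    using c1 c2 b by linarith+
  then have "integral {s..s + T} (running u x) / T \<le> (integral {0..T} (running u x) + 2 * M * s) / T"
    "integral {s..s + T} (running u x) / T \<le> (integral {0..T} (running u x) + 2 * M * T) / T"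
    using T by (auto intro: divide_right_mono)
  then show ?thesis using T by (simp add: add_divide_distrib)
qed

text \<open>The guarantee \<open>c\<close> is averaged over the delays \<open>s \<in> [0, T]\<close>; by Fubini's theorem the inner
integral becomes the average cost over \<open>[t, t + T]\<close>.\<close>

lemma evaluation_of_averages:
  assumes \<theta>: "\<theta> \<in> evaluations" and u: "u \<in> controls U" and x: "x \<in> Y" and T: "0 < T"
    and c: "\<And>s. 0 \<le> s \<Longrightarrow> c \<le> (LINT t|\<theta>. running u x (t + s))"
  shows "c \<le> integral {0..T} (running u x) / T + (LINT t|\<theta>. min (2 * M * t / T) (2 * M))"
proof -
  interpret T: prob_space \<theta> using \<theta> by (simp add: evaluations_def)
  have [measurable_cong]: "sets \<theta> = sets (restrict_space borel {0..})" using \<theta> by (simp add: evaluations_def)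
  have sp: "space \<theta> = {0..}" using sets_eq_imp_space_eq[OF \<open>sets \<theta> = _\<close>] by (simp add: space_restrict_space)
  let ?N = "uniform_evaluation T"
  interpret N: prob_space ?N using uniform_evaluation_in[OF T] by (simp add: evaluations_def)
  interpret P: pair_prob_space \<theta> ?N ..
  have q: "running u x \<in> borel_measurable (restrict_space borel {0..})"
    using running_continuous[OF u x] by (rule borel_measurable_continuous_on_restrict)
  have id: "(\<lambda>t. t) \<in> borel_measurable \<theta>" "(\<lambda>t. t) \<in> borel_measurable ?N"
    by (auto intro!: measurable_restrict_space1 simp: measurable_cong_sets[OF \<open>sets \<theta> = _\<close> refl]
        measurable_cong_sets[OF sets_uniform_evaluation refl])
  have add: "(\<lambda>(t, s). t + s) \<in> \<theta> \<Otimes>\<^sub>M ?N \<rightarrow>\<^sub>M restrict_space borel {0..}"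
  proof (rule measurable_restrict_space2)
    show "(\<lambda>(t, s). t + s) \<in> space (\<theta> \<Otimes>\<^sub>M ?N) \<rightarrow> {0..}"
      by (auto simp: space_pair_measure sp space_uniform_evaluation)
    show "(\<lambda>(t, s). t + s) \<in> borel_measurable (\<theta> \<Otimes>\<^sub>M ?N)"
      unfolding split_beta'
      by (rule borel_measurable_add[OF measurable_compose[OF measurable_fst id(1)]
            measurable_compose[OF measurable_snd id(2)]])
  qed
  have int: "integrable (\<theta> \<Otimes>\<^sub>M ?N) (\<lambda>(t, s). running u x (t + s))"
    using measurable_compose[OF add q] running_bound
    by (intro P.integrable_const_bound[where B = M]) (auto simp: split_beta')
  have min_int: "integrable \<theta> (\<lambda>t. min (2 * M * t / T) (2 * M))"
    using id(1) M_nonneg T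
    by (intro T.integrable_const_bound[where B = "2 * M"]) (auto simp: sp)
  have "c = (LINT s|?N. c)" by (simp add: N.prob_space)
  also have "\<dots> \<le> (LINT s|?N. LINT t|\<theta>. running u x (t + s))"
  proof (rule integral_mono)
    show "integrable ?N (\<lambda>s. LINT t|\<theta>. running u x (t + s))"
      using P.integrable_snd[OF int] by simp
  qed (use c in \<open>auto simp: space_uniform_evaluation\<close>)
  also have "\<dots> = (LINT t|\<theta>. LINT s|?N. running u x (t + s))"
    using P.Fubini_integral[OF int] by simp
  also have "\<dots> \<le> (LINT t|\<theta>. integral {0..T} (running u x) / T + min (2 * M * t / T) (2 * M))"
  proof (rule integral_mono)
    show "integrable \<theta> (\<lambda>t. LINT s|?N. running u x (t + s))"
      using P.integrable_fst[OF int] by simp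
    show "integrable \<theta> (\<lambda>t. integral {0..T} (running u x) / T + min (2 * M * t / T) (2 * M))"
      using min_int by (intro Bochner_Integration.integrable_add) simp_all
    fix t assume "t \<in> space \<theta>"
    then have t: "0 \<le> t" by (simp add: sp)
    have "continuous_on {0..} (running u x \<circ> (\<lambda>s. t + s))"
      using t by (intro continuous_on_compose continuous_intros continuous_on_subset[OF running_continuous[OF u x]]) auto
    then have "(LINT s|?N. running u x (t + s)) = integral {0..T} (\<lambda>s. running u x (t + s)) / T"
      by (intro integral_uniform_evaluation[OF T]) (simp add: o_def)
    also have "\<dots> \<le> integral {0..T} (running u x) / T + min (2 * M * t / T) (2 * M)"
      using average_shift_le[OF u x t T] integral_shift_running[OF u x t, of T] T by simp
    finally show "(LINT s|?N. running u x (t + s)) \<le> \<dots>" .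
  qed
  also have "\<dots> = integral {0..T} (running u x) / T + (LINT t|\<theta>. min (2 * M * t / T) (2 * M))"
    by (subst Bochner_Integration.integral_add[OF _ min_int]) (simp_all add: T.prob_space)
  finally show ?thesis .
qed

text \<open>The error term of the preceding estimate tends to \<open>0\<close> by dominated convergence. It involves neither the
control nor the trajectory, so \<open>T0\<close> is uniform in the control.\<close>

lemma below_Vstar_imp_below_averages:
  assumes x: "x \<in> Y" and c: "ereal c < Vstar U f g x"
  shows "\<exists>T0>0. \<forall>T\<ge>T0. \<forall>u\<in>controls U. c \<le> integral {0..T} (running u x) / T"
proof -
  obtain \<theta> where \<theta>: "\<theta> \<in> evaluations"
    "ereal c < (INF s\<in>{0..}. INF u\<in>controls U. ereal (LINT t|\<theta>. g (trajectory f u x (t + s))))"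
    using c unfolding Vstar_def less_SUP_iff by blast
  obtain c' where c': "c < c'"
    "ereal c' < (INF s\<in>{0..}. INF u\<in>controls U. ereal (LINT t|\<theta>. g (trajectory f u x (t + s))))"
    using ereal_dense2[OF \<theta>(2)] by auto
  have low: "c' \<le> (LINT t|\<theta>. running u x (t + s))" if "0 \<le> s" "u \<in> controls U" for s u
  proof -
    have "(INF s\<in>{0..}. INF u\<in>controls U. ereal (LINT t|\<theta>. g (trajectory f u x (t + s))))
        \<le> ereal (LINT t|\<theta>. g (trajectory f u x (t + s)))"
      using that by (intro INF_lower2[of s] INF_lower2[of u]) auto
    then have "ereal c' \<le> ereal (LINT t|\<theta>. g (trajectory f u x (t + s)))" using c'(2) by (meson less_imp_le order_trans)
    then show ?thesis by (simp add: running_def)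
  qed
  interpret T: prob_space \<theta> using \<theta> by (simp add: evaluations_def)
  have sets: "sets \<theta> = sets (restrict_space borel {0..})" using \<theta> by (simp add: evaluations_def)
  have sp: "space \<theta> = {0..}" using sets_eq_imp_space_eq[OF sets] by (simp add: space_restrict_space)
  have id: "(\<lambda>t. t) \<in> borel_measurable \<theta>"
    by (auto intro!: measurable_restrict_space1 simp: measurable_cong_sets[OF sets refl])
  have "((\<lambda>T. LINT t|\<theta>. min (2 * M * t / T) (2 * M)) \<longlongrightarrow> (LINT t|\<theta>. 0)) at_top"
  proof (rule integral_dominated_convergence_at_top[where w = "\<lambda>_. 2 * M"])
    show "\<forall>\<^sub>F T in at_top. AE t in \<theta>. norm (min (2 * M * t / T) (2 * M)) \<le> 2 * M"
      using eventually_gt_at_top[of 0] by eventually_elim (use M_nonneg in \<open>auto simp: sp\<close>)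
    have "((\<lambda>T. min (2 * M * t / T) (2 * M)) \<longlongrightarrow> min 0 (2 * M)) at_top" for t
      by (intro tendsto_min tendsto_const real_tendsto_divide_at_top[OF tendsto_const] filterlim_ident)
    then show "AE t in \<theta>. ((\<lambda>T. min (2 * M * t / T) (2 * M)) \<longlongrightarrow> 0) at_top"
      using M_nonneg by (simp add: min_def)
  qed (use id in auto)
  then have "\<forall>\<^sub>F T in at_top. (LINT t|\<theta>. min (2 * M * t / T) (2 * M)) < c' - c"
    using c'(1) by (intro order_tendstoD(2)) auto
  then have "\<forall>\<^sub>F T in at_top. 0 < T \<and> (LINT t|\<theta>. min (2 * M * t / T) (2 * M)) < c' - c"
    using eventually_gt_at_top[of "0::real"] by eventually_elim simp
  then obtain T0 where T0: "\<And>T. T \<ge> T0 \<Longrightarrow> 0 < T \<and> (LINT t|\<theta>. min (2 * M * t / T) (2 * M)) < c' - c"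
    by (auto simp: eventually_at_top_linorder)
  have "c \<le> integral {0..T} (running u x) / T" if T: "T \<ge> T0" and u: "u \<in> controls U" for T u
    using evaluation_of_averages[OF \<theta>(1) u x, of T c'] low[OF _ u] T0[OF T] by fastforce
  moreover have "0 < T0" using T0[of T0] by simp
  ultimately show ?thesis by blast
qed

definition unit_step :: "'a \<Rightarrow> real \<Rightarrow> 'a \<Rightarrow> bool" where
  "unit_step x r y \<longleftrightarrow> (\<exists>u\<in>controls U. r = integral {0..1} (running u x) \<and> y = trajectory f u x 1)"

sublocale dp: dynamic_program Y unit_step M
proof
  show "compact Y" by (rule Y_compact)
  show "y \<in> Y" if "x \<in> Y" "unit_step x r y" for x r y
    using that invariant unfolding unit_step_def by auto
  show "\<bar>r\<bar> \<le> M" if x: "x \<in> Y" and st: "unit_step x r y" for x r y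
  proof -
    obtain u where "u \<in> controls U" "r = integral {0..1} (running u x)" using st unfolding unit_step_def by auto
    then show ?thesis using running_integral_bound[OF _ x, of u 0 1] by simp
  qed
  fix e :: real assume e: "0 < e"
  obtain d where d: "0 < d" "\<And>y y'. y \<in> Y \<Longrightarrow> y' \<in> Y \<Longrightarrow> dist y' y < d \<Longrightarrow> dist (g y') (g y) < e"
    using compact_uniformly_continuous[OF g_continuous Y_compact, unfolded uniformly_continuous_on_def] e by metis
  have "\<exists>r' y'. unit_step x' r' y' \<and> dist y y' < \<rho> \<and> \<bar>r - r'\<bar> \<le> e"
    if x: "x \<in> Y" and x': "x' \<in> Y" and st: "unit_step x r y" and near: "dist x x' < \<rho>" and \<rho>: "\<rho> \<le> d" for x x' r y \<rho>
  proof -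
    obtain u where u: "u \<in> controls U" "r = integral {0..1} (running u x)" "y = trajectory f u x 1"
      using st unfolding unit_step_def by auto
    obtain v where v: "v \<in> controls U"
        "\<And>t. t \<in> {0..1} \<Longrightarrow> norm (trajectory f u x t - trajectory f v x' t) < \<rho>"
      using unit_time_response[OF u(1) x x', of \<rho>] near by (auto simp: dist_norm)
    have "norm (integral {0..1} (\<lambda>s. running u x s - running v x' s)) \<le> integral {0..1::real} (\<lambda>_. e)"
    proof (rule integral_norm_bound_integral)
      fix s :: real assume s: "s \<in> {0..1}"
      then have "dist (trajectory f u x s) (trajectory f v x' s) < d" using v(2)[OF s] \<rho> by (simp add: dist_norm)
      then have "dist (g (trajectory f u x s)) (g (trajectory f v x' s)) < e"
        using s u v x x' invariant by (intro d(2)) auto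
      then show "norm (running u x s - running v x' s) \<le> e" by (simp add: running_def dist_norm)
    qed (use running_integrable u v x x' in \<open>auto intro!: integrable_diff\<close>)
    also have "integral {0..1} (\<lambda>s. running u x s - running v x' s)
        = integral {0..1} (running u x) - integral {0..1} (running v x')"
      using running_integrable u v x x' by (intro Henstock_Kurzweil_Integration.integral_diff) auto
    finally have "\<bar>r - integral {0..1} (running v x')\<bar> \<le> e" by (simp add: u(2))
    moreover have "dist y (trajectory f v x' 1) < \<rho>" using v(2)[of 1] by (simp add: u(3) dist_norm)
    ultimately show ?thesis using v(1) unfolding unit_step_def by blast
  qed
  then show "\<exists>d>0. \<forall>x\<in>Y. \<forall>x'\<in>Y. \<forall>r y \<rho>. unit_step x r y \<longrightarrow> dist x x' < \<rho> \<longrightarrow> \<rho> \<le> d \<longrightarrow>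
      (\<exists>r' y'. unit_step x' r' y' \<and> dist y y' < \<rho> \<and> \<bar>r - r'\<bar> \<le> e)"
    using d(1) by (intro exI[of _ d]) auto
qed

lemma play_of_control:
  assumes u: "u \<in> controls U" and x: "x \<in> Y"
  shows "\<exists>rs. dp.play x rs (trajectory f u x (real n)) \<and> length rs = n \<and>
    sum_list rs = integral {0..real n} (running u x)"
proof (induction n)
  case 0
  show ?case using trajectory_0[OF u, of x] by (intro exI[of _ "[]"]) simp
next
  case (Suc n)
  then obtain rs where rs: "dp.play x rs (trajectory f u x (real n))" "length rs = n"
    "sum_list rs = integral {0..real n} (running u x)" by auto
  define r where "r = integral {real n..real n + 1} (running u x)"
  have "unit_step (trajectory f u x (real n)) r (trajectory f u x (real n + 1))"
    unfolding unit_step_def r_def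
    using control_shift[OF u, of "real n"] integral_running_shift[OF u x, of "real n" 1]
      trajectory_shift[OF u, of "real n" 1 x]
    by (intro bexI[of _ "\<lambda>t. u (real n + t)"]) auto
  then have "dp.play x (rs @ [r]) (trajectory f u x (real (Suc n)))"
    unfolding dp.play_append using rs(1) by (auto simp: add.commute)
  moreover have "sum_list (rs @ [r]) = integral {0..real (Suc n)} (running u x)"
    using running_integral_combine[OF u x, of 0 "real n" "real n + 1"] rs(3) by (simp add: r_def add.commute)
  ultimately show ?case using rs(2) by (intro exI[of _ "rs @ [r]"]) auto
qed

text \<open>The uniform evaluation on \<open>[0, N]\<close> yields a delay \<open>s\<close> and a control of average cost less than \<open>c\<close> on
\<open>[s, s + N]\<close>. Rounding \<open>s\<close> up to an integer \<open>m\<close> changes the integral by at most \<open>2 * M\<close>, which is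
negligible for large \<open>N\<close>.\<close>

lemma Vstar_below_imp_good:
  assumes x: "x \<in> Y" and c: "Vstar U f g x < ereal c" and \<epsilon>: "0 < \<epsilon>"
  shows "dp.good (c + \<epsilon>) x"
  unfolding dp.good_def
proof
  fix K
  define N where "N = K + nat \<lceil>2 * M / \<epsilon>\<rceil> + 1"
  have N: "K \<le> N" "0 < real N" "2 * M \<le> \<epsilon> * N"
  proof -
    have "2 * M / \<epsilon> \<le> real N" unfolding N_def using real_nat_ceiling_ge[of "2 * M / \<epsilon>"] by linarith
    then show "2 * M \<le> \<epsilon> * N" using \<epsilon> by (simp add: field_simps)
  qed (simp_all add: N_def)
  have "(INF s\<in>{0..}. INF u\<in>controls U. ereal (LINT t|uniform_evaluation N. g (trajectory f u x (t + s)))) < ereal c"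
  proof (rule le_less_trans[OF _ c])
    show "(INF s\<in>{0..}. INF u\<in>controls U. ereal (LINT t|uniform_evaluation N. g (trajectory f u x (t + s))))
        \<le> Vstar U f g x"
      unfolding Vstar_def by (rule SUP_upper[OF uniform_evaluation_in[OF N(2)]])
  qed
  then obtain s u where s: "0 \<le> s" and u: "u \<in> controls U"
    and avg: "(LINT t|uniform_evaluation N. g (trajectory f u x (t + s))) < c"
    by (auto simp: INF_less_iff)
  have "continuous_on {0..} (running u x \<circ> (\<lambda>t. s + t))"
    using s by (intro continuous_on_compose continuous_intros continuous_on_subset[OF running_continuous[OF u x]]) auto
  then have "(LINT t|uniform_evaluation N. running u x (s + t)) = integral {0..real N} (\<lambda>t. running u x (s + t)) / N"
    by (intro integral_uniform_evaluation[OF N(2)]) (simp add: o_def)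
  then have sN: "integral {s..s + N} (running u x) < c * N"
  proof -
    have "(LINT t|uniform_evaluation N. running u x (s + t)) < c"
      using avg by (simp add: running_def add.commute)
    then have "integral {s..s + N} (running u x) / N < c"
      using \<open>(LINT t|uniform_evaluation N. running u x (s + t)) = _\<close>
        integral_shift_running[OF u x s, of "real N"] by simp
    then show ?thesis using N(2) by (simp add: pos_divide_less_eq)
  qed
  define m where "m = nat \<lceil>s\<rceil>"
  have m: "s \<le> real m" "real m \<le> s + 1" using s by (auto simp: m_def)
  have "integral {real m..real m + N} (running u x) \<le> integral {s..s + N} (running u x) + 2 * M"
  proof -
    have "integral {s..real m + N} (running u x) = integral {s..m} (running u x) + integral {real m..real m + N} (running u x)"
      using running_integral_combine[OF u x s m(1), of "real m + N"] by simp
    moreover have "integral {s..real m + N} (running u x) = integral {s..s + N} (running u x) + integral {s + N..real m + N} (running u x)"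
      using running_integral_combine[OF u x s, of "s + N" "real m + N"] m by simp
    moreover have "M * (real m - s) \<le> M * 1" using m M_nonneg by (intro mult_left_mono) auto
    moreover have "\<bar>integral {s..m} (running u x)\<bar> \<le> M * (real m - s)"
      "\<bar>integral {s + N..real m + N} (running u x)\<bar> \<le> M * (real m - s)"
      using running_integral_bound[OF u x s m(1)] running_integral_bound[OF u x, of "s + N" "real m + N"] s m by auto
    ultimately show ?thesis by linarith
  qed
  then have mN: "integral {real m..real m + N} (running u x) \<le> (c + \<epsilon>) * N"
    using sN N(3) by (simp add: algebra_simps)
  let ?z = "trajectory f u x (real m)" and ?u = "\<lambda>t. u (real m + t)"
  have z: "?z \<in> Y" using invariant[OF x u] by simp
  obtain ss where ss: "dp.play x ss ?z" using play_of_control[OF u x, of m] by auto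
  obtain rs where rs: "dp.play ?z rs (trajectory f ?u ?z (real N))" "length rs = N"
      "sum_list rs = integral {0..real N} (running ?u ?z)"
    using play_of_control[OF control_shift[OF u, of "real m"] z, of N] by auto
  have "sum_list rs \<le> (c + \<epsilon>) * length rs"
    using mN integral_running_shift[OF u x, of "real m" "real N"] by (simp add: rs(2,3))
  then show "\<exists>ss z rs y. dp.play x ss z \<and> dp.play z rs y \<and> K \<le> length rs \<and> sum_list rs \<le> (c + \<epsilon>) * length rs"
    using ss rs N(1) by blast
qed

lemma control_concat:
  assumes u: "\<And>n. u n \<in> controls U"
  shows "(\<lambda>t. u (nat \<lfloor>t\<rfloor>) (t - real (nat \<lfloor>t\<rfloor>))) \<in> controls U"
proof -
  have shift: "(\<lambda>t. max 0 (t - real n)) \<in> restrict_space borel {0..} \<rightarrow>\<^sub>M restrict_space borel {0::real..}" for n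
    by (intro measurable_restrict_space2 measurable_restrict_space1) (auto simp: space_restrict_space)
  have floor: "(\<lambda>t::real. nat \<lfloor>t\<rfloor>) \<in> restrict_space borel {0..} \<rightarrow>\<^sub>M count_space UNIV"
    by (intro measurable_restrict_space1) simp
  have piece: "(\<lambda>t. u n (max 0 (t - real n))) \<in> restrict_space borel {0..} \<rightarrow>\<^sub>M restrict_space borel U" for n
    using measurable_compose[OF shift, of "u n"] u by (simp add: controls_def)
  have "(\<lambda>t. u (nat \<lfloor>t\<rfloor>) (max 0 (t - real (nat \<lfloor>t\<rfloor>)))) \<in> restrict_space borel {0..} \<rightarrow>\<^sub>M restrict_space borel U"
    by (rule measurable_compose_countable[where f = "\<lambda>n t. u n (max 0 (t - real n))", OF piece floor])
  then have "(\<lambda>t. u (nat \<lfloor>t\<rfloor>) (t - real (nat \<lfloor>t\<rfloor>))) \<in> restrict_space borel {0..} \<rightarrow>\<^sub>M restrict_space borel U"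
  proof (rule measurable_cong[THEN iffD1, rotated])
    fix t :: real assume "t \<in> space (restrict_space borel {0..})"
    then have "real (nat \<lfloor>t\<rfloor>) \<le> t" by (simp add: space_restrict_space)
    then show "u (nat \<lfloor>t\<rfloor>) (max 0 (t - real (nat \<lfloor>t\<rfloor>))) = u (nat \<lfloor>t\<rfloor>) (t - real (nat \<lfloor>t\<rfloor>))" by simp
  qed
  then show ?thesis by (simp add: controls_def)
qed

text \<open>The controls of the single moves are concatenated; by induction the resulting trajectory is at
\<open>xs n\<close> at time \<open>n\<close>, because between two integers it follows the control of one move.\<close>

lemma control_of_play:
  assumes xs: "xs 0 \<in> Y" and st: "\<And>n. unit_step (xs n) (rs n) (xs (Suc n))"
  obtains u where "u \<in> controls U" "\<And>n. integral {0..real n} (running u (xs 0)) = (\<Sum>i<n. rs i)"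
proof -
  obtain v where v: "\<And>n. v n \<in> controls U" "\<And>n. rs n = integral {0..1} (running (v n) (xs n))"
    "\<And>n. xs (Suc n) = trajectory f (v n) (xs n) 1"
    using st unfolding unit_step_def by metis
  define u where "u t = v (nat \<lfloor>t\<rfloor>) (t - real (nat \<lfloor>t\<rfloor>))" for t
  have u: "u \<in> controls U" unfolding u_def by (rule control_concat[OF v(1)])
  have u_eq: "u (real n + s) = v n s" if "s \<in> {0..<1}" for n s
  proof -
    have "\<lfloor>real n + s\<rfloor> = int n" using that by (intro floor_unique) auto
    then show ?thesis by (simp add: u_def)
  qed
  have follow: "trajectory f (\<lambda>s. u (real n + s)) (xs n) t = trajectory f (v n) (xs n) t" if "t \<in> {0..1}" for n t
    by (rule trajectory_cong[OF control_shift[OF u] v(1) u_eq that]) auto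
  have reach: "trajectory f u (xs 0) (real n) = xs n" for n
  proof (induction n)
    case 0
    show ?case using trajectory_0[OF u] by simp
  next
    case (Suc n)
    have "trajectory f u (xs 0) (real n + 1) = trajectory f (\<lambda>s. u (real n + s)) (xs n) 1"
      using trajectory_shift[OF u, of "real n" 1 "xs 0"] Suc by simp
    then show ?case using follow[of 1 n] v(3) by (simp add: add.commute)
  qed
  have "integral {0..real n} (running u (xs 0)) = (\<Sum>i<n. rs i)" for n
  proof (induction n)
    case (Suc n)
    have "integral {real n..real n + 1} (running u (xs 0)) = integral {0..1} (running (\<lambda>s. u (real n + s)) (xs n))"
      using integral_running_shift[OF u xs, of "real n" 1] reach by simp
    also have "\<dots> = integral {0..1} (running (v n) (xs n))"
      using follow by (intro Henstock_Kurzweil_Integration.integral_cong) (simp add: running_def)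
    finally show ?case
      using running_integral_combine[OF u xs, of 0 "real n" "real n + 1"] Suc v(2) by (simp add: add.commute)
  qed simp
  with u show thesis by (rule that)
qed

lemma running_set_integral:
  assumes u: "u \<in> controls U" and x: "x \<in> Y"
  shows "(LINT s:{0..t}|lborel. g (trajectory f u x s)) = integral {0..t} (running u x)"
proof -
  have "set_integrable lborel {0..t} (running u x)"
    by (rule borel_integrable_atLeastAtMost') (rule continuous_on_subset[OF running_continuous[OF u x]], auto)
  from set_borel_integral_eq_integral(2)[OF this] show ?thesis
    unfolding running_def[abs_def] .
qed

section \<open>Comparison of the values\<close>

lemma Vstar_le_undiscounted:
  assumes x: "x \<in> Y"
  shows "Vstar U f g x \<le> undiscounted_value U f g x"
proof (rule dense_le)
  fix z assume z: "z < Vstar U f g x"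
  show "z \<le> undiscounted_value U f g x"
    unfolding undiscounted_value_def
  proof (rule INF_greatest)
    fix u assume u: "u \<in> controls U"
    obtain c where c: "z < ereal c" "ereal c < Vstar U f g x" using ereal_dense2[OF z] by auto
    obtain T0 where T0: "0 < T0" "\<And>T. T \<ge> T0 \<Longrightarrow> c \<le> integral {0..T} (running u x) / T"
      using below_Vstar_imp_below_averages[OF x c(2)] u by blast
    have "\<forall>\<^sub>F t in at_top. ereal c \<le> ereal (1 / t * (LINT s:{0..t}|lborel. g (trajectory f u x s)))"
      using eventually_ge_at_top[of T0]
      by eventually_elim (use T0 in \<open>simp add: running_set_integral[OF u x]\<close>)
    then have "ereal c \<le> Limsup at_top (\<lambda>t. ereal (1 / t * (LINT s:{0..t}|lborel. g (trajectory f u x s))))"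
      by (intro le_Limsup) auto
    then show "z \<le> Limsup at_top (\<lambda>t. ereal (1 / t * (LINT s:{0..t}|lborel. g (trajectory f u x s))))"
      using c(1) by simp
  qed
qed

text \<open>The infinite play bounds the cost up to integer times by a line of slope \<open>\<kappa>\<close>; between integer times it
changes by at most \<open>M\<close>. The constants disappear in the average.\<close>

lemma undiscounted_le_of_good:
  assumes x: "x \<in> Y" and g: "dp.good c x" and \<epsilon>: "0 < \<epsilon>"
  shows "undiscounted_value U f g x \<le> ereal (c + \<epsilon>)"
proof -
  define \<kappa> where "\<kappa> = c + \<epsilon> / 2"
  obtain xs rs B where p: "xs 0 = x" "\<And>n. unit_step (xs n) (rs n) (xs (Suc n))"
    "\<And>n. (\<Sum>i<n. rs i) \<le> (c + \<epsilon> / 2) * real n + B"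
    using dp.good_infinite_play[OF x g, of "\<epsilon> / 2"] \<epsilon> by (metis half_gt_zero)
  obtain u where u: "u \<in> controls U" "\<And>n. integral {0..real n} (running u x) = (\<Sum>i<n. rs i)"
    using control_of_play[of xs rs] p(1,2) x by auto
  define C where "C = \<bar>\<kappa>\<bar> + \<bar>B\<bar> + M"
  have bound: "integral {0..t} (running u x) \<le> \<kappa> * t + C" if t: "0 \<le> t" for t
  proof -
    define n where "n = nat \<lfloor>t\<rfloor>"
    have n: "real n \<le> t" "t \<le> real n + 1" using t by (auto simp: n_def)
    have "integral {0..t} (running u x) = integral {0..real n} (running u x) + integral {real n..t} (running u x)"
      using running_integral_combine[OF u(1) x, of 0 "real n" t] n by simp
    also have "\<dots> \<le> (\<kappa> * n + B) + M"
    proof (rule add_mono)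
      show "integral {0..real n} (running u x) \<le> \<kappa> * n + B" using p(3)[of n] by (simp add: u(2) \<kappa>_def)
      have "M * (t - real n) \<le> M * 1" using n M_nonneg by (intro mult_left_mono) auto
      then show "integral {real n..t} (running u x) \<le> M"
        using running_integral_bound[OF u(1) x, of "real n" t] n by linarith
    qed
    also have "\<kappa> * n \<le> \<kappa> * t + \<bar>\<kappa>\<bar>"
    proof -
      have "\<kappa> * (real n - t) \<le> \<bar>\<kappa>\<bar> * \<bar>real n - t\<bar>" by (metis abs_ge_self abs_mult)
      also have "\<dots> \<le> \<bar>\<kappa>\<bar> * 1" using n by (intro mult_left_mono) auto
      finally show ?thesis by (simp add: algebra_simps)
    qed
    finally show ?thesis by (simp add: C_def)
  qed
  have "\<forall>\<^sub>F t in at_top. ereal (1 / t * (LINT s:{0..t}|lborel. g (trajectory f u x s))) \<le> ereal (c + \<epsilon>)"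
    using eventually_gt_at_top[of "0::real"] eventually_ge_at_top[of "2 * C / \<epsilon>"]
  proof eventually_elim
    case (elim t)
    then have "C \<le> \<epsilon> / 2 * t" using \<epsilon> by (simp add: field_simps)
    then have "integral {0..t} (running u x) \<le> (c + \<epsilon>) * t"
      using bound[of t] elim by (simp add: \<kappa>_def algebra_simps)
    then show ?case using elim by (simp add: running_set_integral[OF u(1) x] field_simps)
  qed
  then have "Limsup at_top (\<lambda>t. ereal (1 / t * (LINT s:{0..t}|lborel. g (trajectory f u x s)))) \<le> ereal (c + \<epsilon>)"
    by (rule Limsup_bounded)
  then show ?thesis unfolding undiscounted_value_def using u(1) by (rule INF_lower2[rotated])
qed

theorem undiscounted_eq_Vstar:
  assumes x: "x \<in> Y"
  shows "undiscounted_value U f g x = Vstar U f g x"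
proof (rule antisym[OF dense_ge Vstar_le_undiscounted[OF x]])
  fix z assume "Vstar U f g x < z"
  then obtain c where c: "Vstar U f g x < ereal c" "ereal c < z" using ereal_dense2 by blast
  obtain c' where c': "ereal c < ereal c'" "ereal c' < z" using ereal_dense2[OF c(2)] by blast
  define \<epsilon> where "\<epsilon> = (c' - c) / 2"
  have \<epsilon>: "0 < \<epsilon>" using c'(1) by (simp add: \<epsilon>_def)
  have "undiscounted_value U f g x \<le> ereal (c + \<epsilon> + \<epsilon>)"
    by (rule undiscounted_le_of_good[OF x Vstar_below_imp_good[OF x c(1) \<epsilon>] \<epsilon>])
  also have "c + \<epsilon> + \<epsilon> = c'" by (simp add: \<epsilon>_def)
  finally show "undiscounted_value U f g x \<le> z" using c'(2) by simp
qed

text \<open>By the first defining property, the values for the uniform evaluations on \<open>[0, T]\<close> tend to \<open>V x\<close>. They are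
eventually at least every \<open>c\<close> below \<open>Vstar\<close>, and they are lower bounds for the averages of every
control, so the limit lies between \<open>Vstar\<close> and the undiscounted value, which coincide.\<close>

lemma general_uniform_value_unique:
  assumes V: "general_uniform_value U f g Y V" and x: "x \<in> Y"
  shows "undiscounted_value U f g x = ereal (V x)"
proof -
  have approx: "\<exists>T1. \<forall>T\<ge>T1. 0 < T \<longrightarrow> \<bar>value_at U f g (uniform_evaluation T) x - ereal (V x)\<bar> \<le> ereal \<epsilon>"
    if \<epsilon>: "0 < \<epsilon>" for \<epsilon>
  proof -
    have "\<forall>\<epsilon>>0. \<exists>\<eta>>0. \<exists>S>0. \<forall>\<theta>\<in>evaluations. (SUP s\<in>{0..S}. TV s \<theta>) \<le> \<eta> \<longrightarrow>
        (\<forall>y0\<in>Y. \<bar>value_at U f g \<theta> y0 - ereal (V y0)\<bar> \<le> ereal \<epsilon>)"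
      using V unfolding general_uniform_value_def by (rule conjunct1)
    from this[THEN spec, THEN mp, OF \<epsilon>] obtain \<eta> S where \<eta>: "0 < \<eta>" "0 < S"
      and close: "\<forall>\<theta>\<in>evaluations. (SUP s\<in>{0..S}. TV s \<theta>) \<le> \<eta> \<longrightarrow>
        (\<forall>y0\<in>Y. \<bar>value_at U f g \<theta> y0 - ereal (V y0)\<bar> \<le> ereal \<epsilon>)"
      by (elim exE conjE) (rule that)
    have "\<bar>value_at U f g (uniform_evaluation T) x - ereal (V x)\<bar> \<le> ereal \<epsilon>" if T: "S / \<eta> \<le> T" "0 < T" for T
    proof (rule close[THEN bspec, OF uniform_evaluation_in[OF T(2)], THEN mp, THEN bspec, OF _ x])
      show "(SUP s\<in>{0..S}. TV s (uniform_evaluation T)) \<le> \<eta>"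
      proof (rule cSUP_least)
        fix s assume s: "s \<in> {0..S}"
        then have "TV s (uniform_evaluation T) \<le> s / T" by (intro TV_uniform_evaluation_le[OF T(2)]) auto
        also have "\<dots> \<le> S / T" using s T by (intro divide_right_mono) auto
        also have "\<dots> \<le> \<eta>" using T \<eta>(1) by (simp add: field_simps)
        finally show "TV s (uniform_evaluation T) \<le> \<eta>" .
      qed (use \<eta>(2) in auto)
    qed
    then show ?thesis by blast
  qed
  have value_eq: "value_at U f g (uniform_evaluation T) x = (INF u\<in>controls U. ereal (integral {0..T} (running u x) / T))"
    if "0 < T" for T
    unfolding value_at_def payoff_def
    using integral_uniform_evaluation[OF that running_continuous[OF _ x]]
    by (intro INF_cong) (auto simp: running_def)
  show ?thesis
  proof (rule antisym)
    show "undiscounted_value U f g x \<le> ereal (V x)"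
      unfolding undiscounted_eq_Vstar[OF x]
    proof (rule dense_le)
      fix z assume "z < Vstar U f g x"
      then obtain c where c: "z < ereal c" "ereal c < Vstar U f g x" using ereal_dense2 by blast
      obtain T0 where T0: "0 < T0" "\<And>T u. T \<ge> T0 \<Longrightarrow> u \<in> controls U \<Longrightarrow> c \<le> integral {0..T} (running u x) / T"
        using below_Vstar_imp_below_averages[OF x c(2)] by blast
      have "ereal c \<le> ereal (V x) + ereal \<epsilon>" if \<epsilon>: "0 < \<epsilon>" for \<epsilon>
      proof -
        obtain T1 where T1: "\<And>T. T \<ge> T1 \<Longrightarrow> 0 < T \<Longrightarrow>
            \<bar>value_at U f g (uniform_evaluation T) x - ereal (V x)\<bar> \<le> ereal \<epsilon>"
          using approx[OF \<epsilon>] by blast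
        define T where "T = max T0 T1"
        have "ereal c \<le> value_at U f g (uniform_evaluation T) x"
          using T0 by (subst value_eq) (auto simp: T_def intro!: INF_greatest)
        moreover have "\<bar>value_at U f g (uniform_evaluation T) x - ereal (V x)\<bar> \<le> ereal \<epsilon>"
          using T0 by (intro T1) (auto simp: T_def)
        ultimately show ?thesis
          by (cases "value_at U f g (uniform_evaluation T) x") auto
      qed
      then have "ereal c \<le> ereal (V x)" by (rule ereal_le_epsilon2)
      with c(1) show "z \<le> ereal (V x)" by (metis less_imp_le order_less_le_trans)
    qed
    show "ereal (V x) \<le> undiscounted_value U f g x"
      unfolding undiscounted_value_def
    proof (rule INF_greatest)
      fix u assume u: "u \<in> controls U"
      let ?l = "Limsup at_top (\<lambda>t. ereal (1 / t * (LINT s:{0..t}|lborel. g (trajectory f u x s))))"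
      have "ereal (V x) \<le> ?l + ereal \<epsilon>" if \<epsilon>: "0 < \<epsilon>" for \<epsilon>
      proof -
        obtain T1 where T1: "\<And>T. T \<ge> T1 \<Longrightarrow> 0 < T \<Longrightarrow>
            \<bar>value_at U f g (uniform_evaluation T) x - ereal (V x)\<bar> \<le> ereal \<epsilon>"
          using approx[OF \<epsilon>] by blast
        have "\<forall>\<^sub>F t in at_top. ereal (V x - \<epsilon>) \<le> ereal (1 / t * (LINT s:{0..t}|lborel. g (trajectory f u x s)))"
          using eventually_ge_at_top[of T1] eventually_gt_at_top[of "0::real"]
        proof eventually_elim
          case (elim t)
          have "value_at U f g (uniform_evaluation t) x \<le> ereal (integral {0..t} (running u x) / t)"
            using u elim by (subst value_eq) (auto intro: INF_lower)
          then have "ereal (V x - \<epsilon>) \<le> ereal (integral {0..t} (running u x) / t)"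
            using T1[OF elim] by (cases "value_at U f g (uniform_evaluation t) x") auto
          then show ?case by (simp add: running_set_integral[OF u x])
        qed
        then have "ereal (V x - \<epsilon>) \<le> ?l" by (intro le_Limsup) auto
        then show ?thesis by (cases ?l) auto
      qed
      then show "ereal (V x) \<le> ?l" by (rule ereal_le_epsilon2)
    qed
  qed
qed

end

text \<open>In the infimum over \<open>b\<close> only \<open>(y - z) \<bullet> f z b\<close> varies. Hence any \<open>b\<close> that maximises this term up to \<open>\<epsilon> / 2\<close>
is an approximate minimiser for all \<open>a\<close> simultaneously.\<close>

lemma compact_nonexpansive_response:
  fixes U :: "'u::{metric_space, second_countable_topology} set"
    and f :: "'a::euclidean_space \<Rightarrow> 'u \<Rightarrow> 'a"
  assumes growth: "\<And>u. u \<in> U \<Longrightarrow> norm (f z u) \<le> B"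
    and sup: "(SUP a\<in>U. INF b\<in>U. ereal ((y - z) \<bullet> (f y a - f z b))) \<le> 0"
    and U: "U \<noteq> {}" and \<epsilon>: "0 < \<epsilon>"
  shows "\<exists>b\<in>U. \<forall>a\<in>U. (y - z) \<bullet> f y a \<le> (y - z) \<bullet> f z b + \<epsilon>"
proof -
  define h where "h b = (y - z) \<bullet> f z b" for b
  have "h b \<le> norm (y - z) * B" if "b \<in> U" for b
  proof -
    have "h b \<le> norm (y - z) * norm (f z b)" unfolding h_def by (rule norm_cauchy_schwarz)
    also have "\<dots> \<le> norm (y - z) * B" using growth[OF that] by (intro mult_left_mono) auto
    finally show ?thesis .
  qed
  then have bdd: "bdd_above (h ` U)" by (auto simp: bdd_above_def)
  obtain b where b: "b \<in> U" "(SUP b\<in>U. h b) - \<epsilon> / 2 < h b"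
    using less_cSUP_iff[OF U bdd, of "(SUP b\<in>U. h b) - \<epsilon> / 2"] \<epsilon> by auto
  have "(y - z) \<bullet> f y a \<le> h b + \<epsilon>" if a: "a \<in> U" for a
  proof -
    have "(INF b\<in>U. ereal ((y - z) \<bullet> (f y a - f z b))) \<le> 0"
      using SUP_upper[OF a, of "\<lambda>a. INF b\<in>U. ereal ((y - z) \<bullet> (f y a - f z b))"] sup by (rule order_trans)
    then have "(INF b\<in>U. ereal ((y - z) \<bullet> (f y a - f z b))) < ereal (\<epsilon> / 2)"
      using \<epsilon> by (elim le_less_trans) simp
    then obtain b' where b': "b' \<in> U" "(y - z) \<bullet> (f y a - f z b') < \<epsilon> / 2" by (auto simp: INF_less_iff)
    have "h b' \<le> (SUP b\<in>U. h b)" by (rule cSUP_upper[OF b'(1) bdd])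
    then show ?thesis using b' b by (simp add: h_def inner_diff_right)
  qed
  then show ?thesis using b(1) unfolding h_def by blast
qed

theorem proposition3p4:
  fixes U :: "'u::{metric_space, second_countable_topology} set"
    and f :: "'a::euclidean_space \<Rightarrow> 'u \<Rightarrow> 'a"
    and g :: "'a \<Rightarrow> real"
    and Y :: "'a set"
  assumes "compact_nonexpansive U f g Y"
  shows "(\<forall>y0\<in>Y. undiscounted_value U f g y0 = Vstar U f g y0) \<and>
    (\<forall>V. general_uniform_value U f g Y V \<longrightarrow>
      (\<forall>y0\<in>Y. undiscounted_value U f g y0 = ereal (V y0)))"
proof -
  have problem: "control_problem U f g" and Y: "compact Y" "continuous_on Y g"
    and inv: "\<And>y0 u t. y0 \<in> Y \<Longrightarrow> u \<in> controls U \<Longrightarrow> 0 \<le> t \<Longrightarrow> trajectory f u y0 t \<in> Y"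
    and nonexp: "\<And>y1 y2. (SUP a\<in>U. INF b\<in>U. ereal ((y1 - y2) \<bullet> (f y1 a - f y2 b))) \<le> 0"
    using assms unfolding compact_nonexpansive_def by blast+
  obtain L where L: "0 \<le> L" "\<And>y y' u. u \<in> U \<Longrightarrow> norm (f y u - f y' u) \<le> L * norm (y - y')"
    using problem unfolding control_problem_def by blast
  obtain A where A: "0 < A" "\<And>y u. u \<in> U \<Longrightarrow> norm (f y u) \<le> A * (1 + norm y)"
    using problem unfolding control_problem_def by blast
  obtain M where M: "\<And>y. \<bar>g y\<bar> \<le> M"
    using problem unfolding control_problem_def bounded_iff by auto
  interpret nonexpansive_control U f L A Y g M
  proof
    show "(\<lambda>(y, u). f y u) \<in> borel_measurable (restrict_space borel (UNIV \<times> U))"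
      using problem by (simp add: control_problem_def)
    show "\<exists>b\<in>U. \<forall>a\<in>U. (y - z) \<bullet> f y a \<le> (y - z) \<bullet> f z b + \<epsilon>" if "U \<noteq> {}" "0 < \<epsilon>" for y z \<epsilon>
      by (rule compact_nonexpansive_response[OF A(2) nonexp that])
  qed (use L A M Y inv in auto)
  show ?thesis using undiscounted_eq_Vstar general_uniform_value_unique by blast
qed

end
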